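(* Let $\alpha>0$, let $y_0,r_0\in BV(\mathbb R)$ with $y_0,r_0\ge1$, and let $w_\alpha$ and $v_\alpha$ be bounded, Lipschitz continuous weak solutions with values in $[1,\infty)$ of $\partial_t w=\partial_z\overline{W(w)}$ with initial data $\overline{y_0}$ and $\overline{r_0}$ respectively. If $y_0-r_0\in L^1(\mathbb R)$, then $w_\alpha(\cdot,t)-v_\alpha(\cdot,t)\in L^1(\mathbb R)$ for every $t>0$ and $$\|w_\alpha(\cdot,t)-v_\alpha(\cdot,t)\|_{L^1(\mathbb R)}\le\|y_0-r_0\|_{L^1(\mathbb R)}.$$ In particular, Lipschitz continuous weak solutions are uniquely determined by their initial data.
   Context: Kernel: $\Phi:[0,\infty)\to[0,\infty)$ is non-increasing with $\int_0^\infty\Phi(z)\,dz=1$ and $\int_0^\infty z\Phi(z)\,dz<\infty$; for $\alpha>0$, $\Phi_\alpha(z)=\alpha^{-1}\Phi(z/\alpha)$, and for bounded measurable $h:\mathbb R\to\mathbb R$, $\overline h(z)=\int_0^\infty\Phi_\alpha(\zeta)h(z+\zeta)\,d\zeta$. Flux: $V\in C^1([0,\infty))$ is non-increasing and $W:[1,\infty)\to\mathbb R$, $W(w)=V(1/w)$. A weak solution of $\partial_t w=\partial_z\overline{W(w)}$ on $[0,T]$ with initial datum $w_0$ means $\int_0^T\!\int_{\mathbb R}w\partial_t\varphi-\overline{W(w)}\partial_z\varphi\,dz\,dt=\int_{\mathbb R}w(z,T)\varphi(z,T)-w_0(z)\varphi(z,0)\,dz$ for all $\varphi\in C_0^\infty(\mathbb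 R\times[0,T])$, for every $T>0$. *)

theory Defs
  imports "HOL-Analysis.Analysis"
begin

definition kernel_ok :: "(real \<Rightarrow> real) \<Rightarrow> bool" where
  "kernel_ok \<Phi> \<longleftrightarrow>
     (\<forall>z\<ge>0. \<Phi> z \<ge> 0) \<and>
     (\<forall>x y. 0 \<le> x \<longrightarrow> x \<le> y \<longrightarrow> \<Phi> y \<le> \<Phi> x) \<and>
     set_integrable lborel {0..} \<Phi> \<and> (LINT z:{0..}|lborel. \<Phi> z) = 1 \<and>
     set_integrable lborel {0..} (\<lambda>z. z * \<Phi> z)"

definition kernel_scaled :: "(real \<Rightarrow> real) \<Rightarrow> real \<Rightarrow> real \<Rightarrow> real" where
  "kernel_scaled \<Phi> \<alpha> z = \<Phi> (z / \<alpha>) / \<alpha>"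

definition nl_avg :: "(real \<Rightarrow> real) \<Rightarrow> real \<Rightarrow> (real \<Rightarrow> real) \<Rightarrow> real \<Rightarrow> real" where
  "nl_avg \<Phi> \<alpha> h z = (LINT \<zeta>:{0..}|lborel. kernel_scaled \<Phi> \<alpha> \<zeta> * h (z + \<zeta>))"

definition flux_ok :: "(real \<Rightarrow> real) \<Rightarrow> bool" where
  "flux_ok V \<longleftrightarrow>
     (\<exists>V'. (\<forall>x\<ge>0. (V has_real_derivative V' x) (at x within {0..})) \<and> continuous_on {0..} V') \<and>
     (\<forall>x y. 0 \<le> x \<longrightarrow> x \<le> y \<longrightarrow> V y \<le> V x)"

definition W_of :: "(real \<Rightarrow> real) \<Rightarrow> real \<Rightarrow> real" where
  "W_of V w = V (1 / w)"

definition smooth2 :: "(real \<Rightarrow> real \<Rightarrow> real) \<Rightarrow> bool" where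
  "smooth2 \<phi> \<longleftrightarrow> (\<exists>D :: nat \<Rightarrow> nat \<Rightarrow> real \<Rightarrow> real \<Rightarrow> real.
     D 0 0 = \<phi> \<and>
     (\<forall>i j. continuous_on UNIV (\<lambda>p. D i j (fst p) (snd p)) \<and>
        (\<forall>z t. ((\<lambda>s. D i j s t) has_real_derivative D (Suc i) j z t) (at z) \<and>
               ((\<lambda>s. D i j z s) has_real_derivative D i (Suc j) z t) (at t))))"

text \<open>Test functions C_0^infinity(R x [0,T]): (restrictions of) smooth functions whose support
  in R x [0,T] is compact, i.e. vanish for |z| large.\<close>
definition test_fun :: "real \<Rightarrow> (real \<Rightarrow> real \<Rightarrow> real) \<Rightarrow> bool" where
  "test_fun T \<phi> \<longleftrightarrow> smooth2 \<phi> \<and> (\<exists>R. \<forall>z t. 0 \<le> t \<longrightarrow> t \<le> T \<longrightarrow> \<bar>z\<bar> > R \<longrightarrow> \<phi> z t = 0)"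

text \<open>Weak solution of  w_t = (bar(W(w)))_z  with initial datum w0;  w z t = w(z,t).\<close>
definition weak_solution ::
  "(real \<Rightarrow> real) \<Rightarrow> real \<Rightarrow> (real \<Rightarrow> real) \<Rightarrow> (real \<Rightarrow> real \<Rightarrow> real) \<Rightarrow> (real \<Rightarrow> real) \<Rightarrow> bool" where
  "weak_solution \<Phi> \<alpha> V w w0 \<longleftrightarrow>
     (\<forall>T>0. \<forall>\<phi>. test_fun T \<phi> \<longrightarrow>
        (LINT t:{0..T}|lborel. (LINT z|lborel.
            w z t * deriv (\<lambda>s. \<phi> z s) t
            - nl_avg \<Phi> \<alpha> (\<lambda>x. W_of V (w x t)) z * deriv (\<lambda>s. \<phi> s t) z))
        = (LINT z|lborel. w z T * \<phi> z T - w0 z * \<phi> z 0))"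

definition bounded_var :: "(real \<Rightarrow> real) \<Rightarrow> bool" where
  "bounded_var f \<longleftrightarrow> (\<exists>B. \<forall>(n::nat) (x::nat \<Rightarrow> real).
      (\<forall>i<n. x i < x (Suc i)) \<longrightarrow> (\<Sum>i<n. \<bar>f (x (Suc i)) - f (x i)\<bar>) \<le> B)"

text \<open>BV(R): measurable and a.e. equal to a function of bounded pointwise variation
  (equivalently, finite essential variation).\<close>
definition BV :: "(real \<Rightarrow> real) \<Rightarrow> bool" where
  "BV f \<longleftrightarrow> f \<in> borel_measurable lborel \<and> (\<exists>g. bounded_var g \<and> (AE x in lborel. f x = g x))"

end

theory Submission
  imports Defs
begin

text \<open>
  Let \<open>u = w - v\<close> and \<open>g = W(w) - W(v)\<close>; since \<open>W\<close> is non-decreasing, \<open>sgn u * g = \<bar>g\<bar>\<close>.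
  Testing with smooth approximations of the indicator of \<open>[z, z + h]\<close>, which do not depend on
  time, and taking \<open>h = \<tau>\<^sup>2\<close> gives
  \<open>u(z,t) - u(z,t-\<tau>) = \<tau> * (avg g (z+h) - avg g z) / h + O(\<tau>\<^sup>2)\<close> uniformly in \<open>z\<close>. As the kernel is
  non-increasing, multiplying by \<open>sgn u(z,t)\<close> yields
  \<open>\<bar>u(z,t)\<bar> \<le> \<bar>u(z,t-\<tau>)\<bar> + \<tau> * (avg \<bar>g\<bar> (z+h) - avg \<bar>g\<bar> z) / h + O(\<tau>\<^sup>2)\<close>.
  Integrate against the tent function of height 1 and support \<open>[-R, R]\<close>, shift the difference
  quotient onto the tent, whose slope is \<open>1/R\<close>, and sum over the time steps. Boundedness of \<open>g\<close>
  first gives a crude bound showing \<open>u(t) \<in> L\<^sup>1\<close>; then \<open>g(t) \<in> L\<^sup>1\<close>, so the transport term is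
  \<open>O(1/R)\<close> and vanishes as \<open>R \<rightarrow> \<infinity>\<close>.
\<close>

subsection \<open>Smooth step functions\<close>

text \<open>\<open>flat 0\<close> is the classical smooth function exp(-1/x), extended by 0. Powers
  of 1/x are included so that the derivative of each member is a linear combination of
  members.\<close>

definition flat :: "nat \<Rightarrow> real \<Rightarrow> real" where
  "flat n x = (if x \<le> 0 then 0 else (1 / x) ^ n * exp (- (1 / x)))"

lemma flat_tendsto_0: "(flat n \<longlongrightarrow> 0) (at_right 0)"
proof -
  have "((\<lambda>x::real. (inverse x) ^ n / exp (inverse x)) \<longlongrightarrow> 0) (at_right 0)"
    by (rule filterlim_compose[OF tendsto_power_div_exp_0 filterlim_inverse_at_top_right])
  moreover have "\<forall>\<^sub>F x in at_right 0. (inverse x) ^ n / exp (inverse x) = flat n x"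
    unfolding eventually_at_right_field
    by (intro exI[of _ 1]) (auto simp: flat_def exp_minus field_simps)
  ultimately show ?thesis
    using tendsto_cong by force
qed

lemma flat_has_derivative:
  "(flat n has_real_derivative flat (n + 2) x - real n * flat (n + 1) x) (at x)"
proof -
  consider "x < 0" | "x = 0" | "x > 0" by linarith
  then show ?thesis
  proof cases
    case 1
    have "((\<lambda>_. 0) has_real_derivative 0) (at x)" by simp
    then have "(flat n has_real_derivative 0) (at x)"
      by (rule has_field_derivative_transform_within_open[where S="{..<0}"])
        (use 1 in \<open>auto simp: flat_def\<close>)
    then show ?thesis using 1 by (simp add: flat_def)
  next
    case 2
    have "((\<lambda>y. (flat n y - flat n 0) / (y - 0)) \<longlongrightarrow> 0) (at 0)"
    proof (rule filterlim_split_at)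
      show "((\<lambda>y. (flat n y - flat n 0) / (y - 0)) \<longlongrightarrow> 0) (at_left 0)"
        by (rule tendsto_eventually) (auto simp: eventually_at_left_field flat_def intro!: exI[of _ "-1"])
      \<comment> \<open>The right difference quotient at 0 is \<open>flat (n + 1)\<close> itself,
        which tends to 0.\<close>
      have "\<forall>\<^sub>F y in at_right 0. flat (n + 1) y = (flat n y - flat n 0) / (y - 0)"
        unfolding eventually_at_right_field
        by (intro exI[of _ 1]) (auto simp: flat_def field_simps)
      then show "((\<lambda>y. (flat n y - flat n 0) / (y - 0)) \<longlongrightarrow> 0) (at_right 0)"
        using flat_tendsto_0[of "n + 1"] tendsto_cong by force
    qed
    then show ?thesis
      using 2 by (simp add: has_field_derivative_iff flat_def)
  next
    case 3
    have "((\<lambda>x. (1 / x) ^ n * exp (- (1 / x))) has_real_derivative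
        flat (n + 2) x - real n * flat (n + 1) x) (at x)"
      using 3 by (cases "n \<in> {0, 1}"; cases n; auto intro!: derivative_eq_intros
          simp: flat_def divide_simps power2_eq_square)
        (simp_all add: algebra_simps flip: power_Suc)
    then show ?thesis
      by (rule has_field_derivative_transform_within_open[where S="{0<..}"])
        (use 3 in \<open>auto simp: flat_def\<close>)
  qed
qed

text \<open>With an inductive class, closure under differentiation is a single induction. The rule
  \<open>antiderivative\<close> admits the primitive of a bump, whose derivative lies in the class
  by the premise.\<close>

inductive_set smooth_funs :: "(real \<Rightarrow> real) set" where
  flat: "flat n \<in> smooth_funs"
| const: "(\<lambda>_. c) \<in> smooth_funs"
| add: "f \<in> smooth_funs \<Longrightarrow> g \<in> smooth_funs \<Longrightarrow> (\<lambda>x. f x + g x) \<in> smooth_funs"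
| mult: "f \<in> smooth_funs \<Longrightarrow> g \<in> smooth_funs \<Longrightarrow> (\<lambda>x. f x * g x) \<in> smooth_funs"
| affine: "f \<in> smooth_funs \<Longrightarrow> (\<lambda>x. f (a * x + b)) \<in> smooth_funs"
| antiderivative: "f \<in> smooth_funs \<Longrightarrow> (\<And>x. (F has_real_derivative f x) (at x)) \<Longrightarrow> F \<in> smooth_funs"

lemma smooth_funs_derivative:
  "f \<in> smooth_funs \<Longrightarrow> \<exists>f'\<in>smooth_funs. \<forall>x. (f has_real_derivative f' x) (at x)"
proof (induction rule: smooth_funs.induct)
  case (flat n)
  have "(\<lambda>x. flat (n + 2) x + (- real n) * flat (n + 1) x) \<in> smooth_funs"
    by (intro smooth_funs.flat smooth_funs.const smooth_funs.add smooth_funs.mult smooth_funs.affine)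
  with flat_has_derivative[of n] show ?case by (intro bexI) auto
next
  case (const c)
  show ?case by (rule bexI[of _ "\<lambda>_. 0"]) (auto intro: smooth_funs.const)
next
  case (add f g)
  then obtain f' g' where "f' \<in> smooth_funs" "g' \<in> smooth_funs"
    "\<forall>x. (f has_real_derivative f' x) (at x)" "\<forall>x. (g has_real_derivative g' x) (at x)" by blast
  then show ?case
    by (intro bexI[of _ "\<lambda>x. f' x + g' x"]) (auto intro!: smooth_funs.add DERIV_add)
next
  case (mult f g)
  then obtain f' g' where "f' \<in> smooth_funs" "g' \<in> smooth_funs"
    "\<forall>x. (f has_real_derivative f' x) (at x)" "\<forall>x. (g has_real_derivative g' x) (at x)" by blast
  with mult.hyps show ?case
    by (intro bexI[of _ "\<lambda>x. f' x * g x + g' x * f x"]) (auto intro!: smooth_funs.add smooth_funs.mult DERIV_mult)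
next
  case (affine f a b)
  then obtain f' where f': "f' \<in> smooth_funs" "\<And>x. (f has_real_derivative f' x) (at x)" by blast
  have "((\<lambda>x. f (a * x + b)) has_real_derivative a * f' (a * x + b)) (at x)" for x
  proof -
    have "((\<lambda>x. a * x + b) has_real_derivative a) (at x)"
      by (auto intro!: derivative_eq_intros)
    from DERIV_chain2[OF f'(2) this] show ?thesis by (simp add: mult.commute)
  qed
  moreover have "(\<lambda>x. a * f' (a * x + b)) \<in> smooth_funs"
    by (rule smooth_funs.mult[OF smooth_funs.const smooth_funs.affine[OF f'(1)]])
  ultimately show ?case by (intro bexI[of _ "\<lambda>x. a * f' (a * x + b)"]) auto
next
  case (antiderivative f F)
  then show ?case by blast
qed

lemma smooth_funs_all_derivatives:
  assumes "f \<in> smooth_funs"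
  obtains D :: "nat \<Rightarrow> real \<Rightarrow> real"
  where "D 0 = f" "\<And>i x. (D i has_real_derivative D (Suc i) x) (at x)"
proof -
  \<comment> \<open>Choice turns the existence of a derivative inside the class into an operator
    that can be iterated.\<close>
  define d where "d f = (SOME f'. f' \<in> smooth_funs \<and> (\<forall>x. (f has_real_derivative f' x) (at x)))" for f
  have d: "d f \<in> smooth_funs \<and> (\<forall>x. (f has_real_derivative d f x) (at x))" if "f \<in> smooth_funs" for f
    using someI_ex[of "\<lambda>f'. f' \<in> smooth_funs \<and> (\<forall>x. (f has_real_derivative f' x) (at x))"]
      smooth_funs_derivative[OF that] unfolding d_def by blast
  have mem: "(d ^^ i) f \<in> smooth_funs" for i
    by (induction i) (use assms d in auto)
  show ?thesis
    by (rule that[of "\<lambda>i. (d ^^ i) f"]) (use d[OF mem] in auto)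
qed

lemma test_fun_time_independent:
  assumes "f \<in> smooth_funs" and "\<And>z. \<bar>z\<bar> > R \<Longrightarrow> f z = 0"
  shows "test_fun T (\<lambda>z t. f z)"
proof -
  obtain D where D: "D 0 = f" "\<And>i x. (D i has_real_derivative D (Suc i) x) (at x)"
    by (rule smooth_funs_all_derivatives[OF assms(1)]) blast
  have [continuous_intros]: "continuous_on UNIV (D i)" for i
    using D(2) by (meson DERIV_isCont continuous_at_imp_continuous_on)
  have "smooth2 (\<lambda>z t. f z)"
    unfolding smooth2_def
  \<comment> \<open>All time derivatives vanish, so only the entries with \<open>j = 0\<close> are
    nonzero.\<close>
  proof (intro exI[of _ "\<lambda>i j z t. if j = 0 then D i z else 0"] conjI allI)
    show "continuous_on UNIV (\<lambda>p::real\<times>real. if j = 0 then D i (fst p) else 0)" for i j :: nat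
      by (cases "j = 0") (auto intro!: continuous_on_compose2[of UNIV "D i" UNIV fst] continuous_intros)
  qed (use D in auto)
  then show ?thesis using assms(2) unfolding test_fun_def by blast
qed

lemma integrable_continuous_compact_support:
  fixes f :: "real \<Rightarrow> real"
  assumes "continuous_on UNIV f" "\<And>x. x \<notin> {a..b} \<Longrightarrow> f x = 0"
  shows "integrable lborel f"
proof -
  have "set_integrable lborel {a..b} f"
    by (rule borel_integrable_atLeastAtMost') (rule continuous_on_subset[OF assms(1)], simp)
  moreover have "(\<lambda>x. indicator {a..b} x *\<^sub>R f x) = f"
    using assms(2) by (auto simp: indicator_def fun_eq_iff)
  ultimately show ?thesis by (simp add: set_integrable_def)
qed

text \<open>\<open>S\<close> is the normalised primitive of a bump and \<open>e\<close> its
  derivative. Differences of translates of \<open>S\<close> serve as smoothed indicators of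
  intervals, and translates of \<open>e\<close> as mollifiers.\<close>

lemma smooth_step:
  fixes \<delta> :: real
  assumes "\<delta> > 0"
  obtains S e :: "real \<Rightarrow> real" where "S \<in> smooth_funs" "\<And>x. (S has_real_derivative e x) (at x)"
    "\<And>x. isCont e x" "\<And>x. e x \<ge> 0" "\<And>x. x \<notin> {0..\<delta>} \<Longrightarrow> e x = 0"
    "\<And>x. x \<le> 0 \<Longrightarrow> S x = 0" "\<And>x. x \<ge> \<delta> \<Longrightarrow> S x = 1" "mono S"
    "integral\<^sup>L lborel e = 1"
proof -
  \<comment> \<open>This product is positive exactly between 0 and \<delta>. The second argument has
    the shape demanded by the rule \<open>affine\<close>.\<close>
  define b where "b x = flat 0 x * flat 0 ((-1) * x + \<delta>)" for x
  have b_smooth: "b \<in> smooth_funs"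
    unfolding b_def by (intro smooth_funs.flat smooth_funs.const smooth_funs.add smooth_funs.mult smooth_funs.affine)
  have b_cont: "isCont b x" for x
    using smooth_funs_derivative[OF b_smooth] DERIV_isCont by blast
  have b_nonneg: "b x \<ge> 0" and b_zero: "x \<notin> {0..\<delta>} \<Longrightarrow> b x = 0"
    and b_pos: "0 < x \<Longrightarrow> x < \<delta> \<Longrightarrow> b x > 0" for x
    by (auto simp: b_def flat_def)
  obtain F where F: "\<And>x. (F has_real_derivative b x) (at x)"
    using einterval_antiderivative[of "-\<infinity>" "\<infinity>" b] b_cont
    by (auto simp: has_real_derivative_iff_has_vector_derivative)
  have F_mono: "F x \<le> F y" if "x \<le> y" for x y
    using DERIV_nonneg_imp_nondecreasing[OF that] F b_nonneg by blast
  have F_cont: "continuous_on A F" for A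
    using F by (meson DERIV_isCont continuous_at_imp_continuous_on)
  have F_less: "F 0 < F \<delta>"
    by (rule DERIV_pos_imp_increasing_open[OF assms _ F_cont]) (use F b_pos in blast)
  have F_left: "F x = F 0" if "x \<le> 0" for x
  proof (cases "x = 0")
    case False
    show ?thesis
      by (rule sym, rule DERIV_isconst2[of x 0 F]) (use False that F F_cont b_zero in \<open>auto, metis atLeastAtMost_iff not_le\<close>)
  qed simp
  have F_right: "F x = F \<delta>" if "x \<ge> \<delta>" for x
  proof (cases "x = \<delta>")
    case False
    show ?thesis
      by (rule DERIV_isconst2[of \<delta> x F]) (use False that F F_cont b_zero in \<open>auto, metis atLeastAtMost_iff not_le\<close>)
  qed simp
  define c where "c = 1 / (F \<delta> - F 0)"
  have c: "c > 0" using F_less by (simp add: c_def)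
  have F_smooth: "F \<in> smooth_funs"
    by (rule smooth_funs.antiderivative[OF b_smooth F])
  have "(LINT x|lborel. b x * indicator {0..\<delta>} x) = F \<delta> - F 0"
    by (rule integral_FTC_Icc_real) (use assms F b_cont in auto)
  moreover have "(\<lambda>x. b x * indicator {0..\<delta>} x) = b"
    using b_zero by (auto simp: indicator_def fun_eq_iff)
  ultimately have b_int: "integral\<^sup>L lborel b = F \<delta> - F 0" by simp
  show ?thesis
  proof (rule that[of "\<lambda>x. c * (F x + (- F 0))" "\<lambda>x. c * b x"])
    show "(\<lambda>x. c * (F x + (- F 0))) \<in> smooth_funs"
      by (intro smooth_funs.const smooth_funs.add smooth_funs.mult F_smooth)
    show "((\<lambda>x. c * (F x + (- F 0))) has_real_derivative c * b x) (at x)" for x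
      by (auto intro!: derivative_eq_intros F)
    show "isCont (\<lambda>x. c * b x) x" for x using b_cont by (intro continuous_intros)
    show "mono (\<lambda>x. c * (F x + (- F 0)))" using c F_mono by (auto intro!: monoI)
    show "c * (F x + - F 0) = 1" if "x \<ge> \<delta>" for x
      using F_right[OF that] F_less by (simp add: c_def)
    show "c * (F x + - F 0) = 0" if "x \<le> 0" for x
      using F_left[OF that] by simp
    show "(LINT x|lborel. c * b x) = 1"
      using b_int F_less by (simp add: c_def)
  qed (use c b_nonneg b_zero in auto)
qed

subsection \<open>One-sided averages\<close>

lemma integrable_mult_bounded:
  fixes f h :: "real \<Rightarrow> real"
  assumes "integrable lborel f" "h \<in> borel_measurable borel" "\<And>x. \<bar>h x\<bar> \<le> M"
  shows "integrable lborel (\<lambda>x. f x * h x)"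
proof (rule Bochner_Integration.integrable_bound[of _ "\<lambda>x. M * f x"])
  show "AE x in lborel. norm (f x * h x) \<le> norm (M * f x)"
  proof (rule AE_I2)
    fix x
    have "\<bar>h x\<bar> \<le> \<bar>M\<bar>" using assms(3)[of x] by linarith
    then show "norm (f x * h x) \<le> norm (M * f x)"
      unfolding real_norm_def abs_mult mult.commute[of "\<bar>M\<bar>"] by (rule mult_left_mono) simp
  qed
qed (use assms in auto)

text \<open>The kernel is extended by 0 to the whole line, so that shifting it is a translation and
  integrals run over \<open>lborel\<close>. At 0 the extension may jump upwards; monotonicity starts
  there.\<close>

locale averaging_kernel =
  fixes k :: "real \<Rightarrow> real"
  assumes k_nonneg: "k x \<ge> 0"
    and k_neg: "x < 0 \<Longrightarrow> k x = 0"
    and k_antimono: "0 \<le> x \<Longrightarrow> x \<le> y \<Longrightarrow> k y \<le> k x"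
    and k_integrable: "integrable lborel k"
    and k_integral: "integral\<^sup>L lborel k = 1"
begin

definition avg :: "(real \<Rightarrow> real) \<Rightarrow> real \<Rightarrow> real" where
  "avg h z = (LINT \<zeta>|lborel. k \<zeta> * h (z + \<zeta>))"

lemma k_measurable [measurable]: "k \<in> borel_measurable borel"
  using k_integrable by (auto dest: borel_measurable_integrable)

lemma k_le: "k x \<le> k 0"
  using k_antimono[of 0 x] k_neg[of x] k_nonneg[of 0] by (cases "x < 0") auto

lemma k_shift_integrable: "integrable lborel (\<lambda>x. k (x - d))"
  using lborel_integrable_real_affine[OF k_integrable, of 1 "- d"] by simp

lemma k_shift_integral: "(LINT x|lborel. k (x - d)) = 1"
  using lborel_integral_real_affine[of 1 k "- d"] k_integral by simp

lemma avg_integrable: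
  assumes "h \<in> borel_measurable borel" "\<And>x. \<bar>h x\<bar> \<le> M"
  shows "integrable lborel (\<lambda>\<zeta>. k \<zeta> * h (z + \<zeta>))"
  by (rule integrable_mult_bounded[OF k_integrable]) (use assms in auto)

lemma avg_abs_le:
  assumes "h \<in> borel_measurable borel" "\<And>x. \<bar>h x\<bar> \<le> M"
  shows "\<bar>avg h z\<bar> \<le> M"
proof -
  have "\<bar>avg h z\<bar> \<le> (LINT \<zeta>|lborel. \<bar>k \<zeta> * h (z + \<zeta>)\<bar>)"
    unfolding avg_def by (rule integral_abs_bound)
  also have "\<dots> \<le> (LINT \<zeta>|lborel. M * k \<zeta>)"
  proof (rule integral_mono)
    show "\<bar>k \<zeta> * h (z + \<zeta>)\<bar> \<le> M * k \<zeta>" for \<zeta>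
      using assms(2)[of "z + \<zeta>"] k_nonneg[of \<zeta>] 
      by (simp add: abs_mult mult.commute[of M] mult_left_mono)
  qed (use avg_integrable[OF assms] k_integrable in auto)
  also have "\<dots> = M" using k_integral by simp
  finally show ?thesis .
qed

lemma avg_diff:
  assumes "f \<in> borel_measurable borel" "\<And>x. \<bar>f x\<bar> \<le> M"
    and "g \<in> borel_measurable borel" "\<And>x. \<bar>g x\<bar> \<le> N"
  shows "avg (\<lambda>x. f x - g x) z = avg f z - avg g z"
  unfolding avg_def right_diff_distrib
  by (rule Bochner_Integration.integral_diff) (rule avg_integrable; use assms in blast)+

text \<open>Translating the variable moves the shift from \<open>h\<close> onto the kernel, so
  increments of averages can be estimated without any regularity of \<open>h\<close>.\<close>

lemma avg_shift: "avg h (z + d) = (LINT \<zeta>|lborel. k (\<zeta> - d) * h (z + \<zeta>))"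
  unfolding avg_def
  using lborel_integral_real_affine[of 1 "\<lambda>\<zeta>. k (\<zeta> - d) * h (z + \<zeta>)" d] by (simp add: algebra_simps)

lemma avg_shift_diff:
  assumes "h \<in> borel_measurable borel" "\<And>x. \<bar>h x\<bar> \<le> M"
  shows "avg h (z + d) - avg h z = (LINT \<zeta>|lborel. (k (\<zeta> - d) - k \<zeta>) * h (z + \<zeta>))"
    and "integrable lborel (\<lambda>\<zeta>. (k (\<zeta> - d) - k \<zeta>) * h (z + \<zeta>))"
proof -
  have 1: "integrable lborel (\<lambda>\<zeta>. k (\<zeta> - d) * h (z + \<zeta>))"
    by (rule integrable_mult_bounded[OF k_shift_integrable]) (use assms in auto)
  show "avg h (z + d) - avg h z = (LINT \<zeta>|lborel. (k (\<zeta> - d) - k \<zeta>) * h (z + \<zeta>))"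
    unfolding avg_shift left_diff_distrib
    by (subst Bochner_Integration.integral_diff[OF 1 avg_integrable[OF assms]]) (simp add: avg_def)
  show "integrable lborel (\<lambda>\<zeta>. (k (\<zeta> - d) - k \<zeta>) * h (z + \<zeta>))"
    unfolding left_diff_distrib
    by (rule Bochner_Integration.integrable_diff[OF 1 avg_integrable[OF assms]])
qed

lemma k_initial_integral:
  assumes "d \<ge> 0"
  shows "integrable lborel (\<lambda>x. k x * indicator {0..<d} x)"
    and "(LINT x|lborel. k x * indicator {0..<d} x) \<le> k 0 * d"
proof -
  show *: "integrable lborel (\<lambda>x. k x * indicator {0..<d} x)"
    by (rule integrable_mult_bounded[OF k_integrable, where M=1]) (auto simp: indicator_def)
  have "(LINT x|lborel. k x * indicator {0..<d} x) \<le> (LINT x|lborel. k 0 * indicator {0..<d} x)"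
    by (rule integral_mono[OF *]) (use k_le assms in \<open>auto split: split_indicator\<close>)
  also have "\<dots> = k 0 * d" using assms by simp
  finally show "(LINT x|lborel. k x * indicator {0..<d} x) \<le> k 0 * d" .
qed

text \<open>The increment \<open>k (\<zeta> - d) - k \<zeta>\<close> has integral 0 and is negative
  at most on \<open>[0, d)\<close>, where it equals \<open>- k \<zeta>\<close>. Its L1 norm is
  therefore twice the kernel mass of that interval, at most \<open>2 * k 0 * d\<close>. The function
  \<open>?m\<close> is its absolute value.\<close>

lemma avg_shift_le:
  assumes "h \<in> borel_measurable borel" "\<And>x. \<bar>h x\<bar> \<le> M" "d \<ge> 0"
  shows "\<bar>avg h (z + d) - avg h z\<bar> \<le> 2 * k 0 * M * d"
proof -
  have M: "M \<ge> 0" using assms(2)[of 0] by linarith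
  let ?m = "\<lambda>\<zeta>. k (\<zeta> - d) - k \<zeta> + 2 * (k \<zeta> * indicator {0..<d} \<zeta>)"
  note int = k_shift_integrable[of d] k_integrable k_initial_integral(1)[OF assms(3)]
  have m: "\<bar>k (\<zeta> - d) - k \<zeta>\<bar> \<le> ?m \<zeta>" for \<zeta>
  proof -
    consider "\<zeta> < 0" | "0 \<le> \<zeta>" "\<zeta> < d" | "\<zeta> \<ge> d" by linarith
    then show ?thesis
      using k_nonneg[of \<zeta>] k_neg[of \<zeta>] k_neg[of "\<zeta> - d"] k_antimono[of "\<zeta> - d" \<zeta>] assms(3)
      by cases auto
  qed
  have "\<bar>avg h (z + d) - avg h z\<bar> \<le> (LINT \<zeta>|lborel. \<bar>(k (\<zeta> - d) - k \<zeta>) * h (z + \<zeta>)\<bar>)"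
    unfolding avg_shift_diff(1)[OF assms(1,2)] by (rule integral_abs_bound)
  also have "\<dots> \<le> (LINT \<zeta>|lborel. M * ?m \<zeta>)"
  proof (rule integral_mono)
    show "\<bar>(k (\<zeta> - d) - k \<zeta>) * h (z + \<zeta>)\<bar> \<le> M * ?m \<zeta>" for \<zeta>
      unfolding abs_mult mult.commute[of M]
      by (rule mult_mono) (use m[of \<zeta>] assms(2) in auto)
  qed (use avg_shift_diff(2)[OF assms(1,2)] int in auto)
  also have "\<dots> = M * (2 * (LINT x|lborel. k x * indicator {0..<d} x))"
    using int k_integral k_shift_integral by simp
  also have "\<dots> \<le> M * (2 * (k 0 * d))"
    using k_initial_integral(2)[OF assms(3)] M by (intro mult_left_mono) auto
  finally show ?thesis by (simp add: mult_ac)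
qed

lemma avg_lipschitz:
  assumes "h \<in> borel_measurable borel" "\<And>x. \<bar>h x\<bar> \<le> B"
  shows "\<bar>avg h x - avg h y\<bar> \<le> 2 * k 0 * B * \<bar>x - y\<bar>"
  using avg_shift_le[OF assms, of "\<bar>x - y\<bar>" "min x y"] by (auto simp: min_def abs_if split: if_splits)

text \<open>Shifting the argument of \<open>avg\<close> to the right moves kernel mass from \<open>[0, d)\<close> to the
  positive function \<open>k (\<zeta> - d) - k \<zeta>\<close>, so a non-negative function can only lose what it
  has on \<open>[z, z + d)\<close>.\<close>

lemma avg_shift_ge:
  assumes "q \<in> borel_measurable borel" "\<And>x. \<bar>q x\<bar> \<le> M" "\<And>x. q x \<ge> 0" "d \<ge> 0"
    and small: "\<And>x. z \<le> x \<Longrightarrow> x < z + d \<Longrightarrow> q x \<le> m"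
  shows "avg q (z + d) - avg q z \<ge> - (k 0 * d * m)"
proof (cases "d = 0")
  case False
  with assms(4) have "d > 0" by simp
  \<comment> \<open>The point \<open>z\<close> belongs to the half-open interval only if
    \<open>d > 0\<close>; hence the case distinction.\<close>
  then have m: "m \<ge> 0" using assms(3)[of z] small[of z] by linarith
  note int = k_initial_integral(1)[OF assms(4)]
  have "- (k 0 * d * m) \<le> - m * (LINT x|lborel. k x * indicator {0..<d} x)"
    using mult_left_mono[OF k_initial_integral(2)[OF assms(4)] m] by (simp add: mult_ac)
  also have "\<dots> = (LINT x|lborel. - m * (k x * indicator {0..<d} x))" by simp
  also have "\<dots> \<le> (LINT \<zeta>|lborel. (k (\<zeta> - d) - k \<zeta>) * q (z + \<zeta>))"
  proof (rule integral_mono[OF _ avg_shift_diff(2)[OF assms(1,2)]])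
    fix \<zeta>
    consider "\<zeta> < 0" | "0 \<le> \<zeta>" "\<zeta> < d" | "\<zeta> \<ge> d" by linarith
    then show "- m * (k \<zeta> * indicator {0..<d} \<zeta>) \<le> (k (\<zeta> - d) - k \<zeta>) * q (z + \<zeta>)"
    proof cases
      case 2
      then show ?thesis
        using small[of "z + \<zeta>"] k_neg[of "\<zeta> - d"] k_nonneg[of \<zeta>]
        by (simp add: mult.commute[of m] mult_left_mono)
    next
      case 3
      then have "(k (\<zeta> - d) - k \<zeta>) * q (z + \<zeta>) \<ge> 0"
        using k_antimono[of "\<zeta> - d" \<zeta>] assms(3,4) by simp
      then show ?thesis using 3 by simp
    qed (use k_neg[of \<zeta>] k_neg[of "\<zeta> - d"] assms(4) in auto)
  qed (use int in auto)
  also have "\<dots> = avg q (z + d) - avg q z" by (simp add: avg_shift_diff(1)[OF assms(1,2)])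
  finally show ?thesis .
qed simp

text \<open>Tonelli and the unit mass of the kernel. Working with nonnegative integrals first avoids
  assuming that \<open>f\<close> is bounded.\<close>

lemma avg_L1:
  assumes "integrable lborel f"
  shows "integrable lborel (avg f)" "(LINT z|lborel. \<bar>avg f z\<bar>) \<le> (LINT z|lborel. \<bar>f z\<bar>)"
proof -
  have [measurable]: "f \<in> borel_measurable borel" using assms by auto
  have meas: "avg f \<in> borel_measurable lborel" unfolding avg_def by measurable
  have "(\<integral>\<^sup>+z. norm (avg f z) \<partial>lborel) \<le> (\<integral>\<^sup>+z. (\<integral>\<^sup>+\<zeta>. ennreal (k \<zeta>) * ennreal (norm (f (z + \<zeta>))) \<partial>lborel) \<partial>lborel)"
  proof (rule nn_integral_mono)
    fix z
    show "ennreal (norm (avg f z)) \<le> (\<integral>\<^sup>+\<zeta>. ennreal (k \<zeta>) * ennreal (norm (f (z + \<zeta>))) \<partial>lborel)"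
    proof (cases "integrable lborel (\<lambda>\<zeta>. k \<zeta> * f (z + \<zeta>))")
      case True
      show ?thesis
        using integral_norm_bound_ennreal[OF True] k_nonneg
        unfolding avg_def by (simp add: abs_mult ennreal_mult)
    next
      \<comment> \<open>The Bochner integral then has the default value 0, and the bound is
        trivial.\<close>
      case False
      then show ?thesis unfolding avg_def by (simp add: not_integrable_integral_eq)
    qed
  qed
  also have "\<dots> = (\<integral>\<^sup>+\<zeta>. (\<integral>\<^sup>+z. ennreal (k \<zeta>) * ennreal (norm (f (z + \<zeta>))) \<partial>lborel) \<partial>lborel)"
    by (rule lborel_pair.Fubini') measurable
  also have "\<dots> = (\<integral>\<^sup>+\<zeta>. ennreal (k \<zeta>) * (\<integral>\<^sup>+z. ennreal (norm (f z)) \<partial>lborel) \<partial>lborel)"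
  proof (rule nn_integral_cong)
    fix \<zeta>
    have "(\<integral>\<^sup>+z. ennreal (norm (f (z + \<zeta>))) \<partial>lborel) = (\<integral>\<^sup>+z. ennreal (norm (f z)) \<partial>lborel)"
      using nn_integral_real_affine[of "\<lambda>z. ennreal (norm (f z))" 1 \<zeta>] by (simp add: add.commute)
    then show "(\<integral>\<^sup>+z. ennreal (k \<zeta>) * ennreal (norm (f (z + \<zeta>))) \<partial>lborel)
        = ennreal (k \<zeta>) * (\<integral>\<^sup>+z. ennreal (norm (f z)) \<partial>lborel)"
      by (subst nn_integral_cmult) auto
  qed
  also have "\<dots> = (\<integral>\<^sup>+\<zeta>. ennreal (k \<zeta>) \<partial>lborel) * (\<integral>\<^sup>+z. ennreal (norm (f z)) \<partial>lborel)"
    by (rule nn_integral_multc) auto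
  also have "(\<integral>\<^sup>+\<zeta>. ennreal (k \<zeta>) \<partial>lborel) = 1"
    using nn_integral_eq_integral[OF k_integrable] k_nonneg k_integral by simp
  finally have le: "(\<integral>\<^sup>+z. norm (avg f z) \<partial>lborel) \<le> ennreal (LINT z|lborel. norm (f z))"
    using nn_integral_eq_integral[OF integrable_norm[OF assms]] by simp
  show int: "integrable lborel (avg f)"
    using meas le by (intro integrableI_bounded) (auto simp: le_less_trans[OF _ ennreal_less_top])
  show "(LINT z|lborel. \<bar>avg f z\<bar>) \<le> (LINT z|lborel. \<bar>f z\<bar>)"
    using le nn_integral_eq_integral[OF integrable_norm[OF int]] by (simp add: ennreal_le_iff)
qed

text \<open>Allows BV data, which are bounded only up to a null set, to be replaced by bounded
  representatives.\<close>

lemma avg_AE_cong: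
  assumes "AE x in lborel. f x = g x" and [measurable]: "f \<in> borel_measurable borel" "g \<in> borel_measurable borel"
  shows "avg f z = avg g z"
proof -
  have "AE x in lborel. f (z + x) = g (z + x)"
    using AE_borel_affine[of 1 "\<lambda>x. f x = g x" z] assms by simp
  then show ?thesis unfolding avg_def
    by (intro integral_cong_AE) auto
qed

end

lemma averaging_kernel_scaled:
  assumes "kernel_ok \<Phi>" "\<alpha> > 0"
  shows "averaging_kernel (\<lambda>z. indicator {0..} z * kernel_scaled \<Phi> \<alpha> z)"
proof
  have int: "integrable lborel (\<lambda>z. indicator {0..} z * \<Phi> z)"
    and one: "(LINT z|lborel. indicator {0..} z * \<Phi> z) = 1"
    using assms(1) by (auto simp: kernel_ok_def set_integrable_def set_lebesgue_integral_def)
  have eq: "(\<lambda>z. indicator {0..} z * kernel_scaled \<Phi> \<alpha> z)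
      = (\<lambda>z. (indicator {0..} (0 + (1 / \<alpha>) * z) * \<Phi> (0 + (1 / \<alpha>) * z)) / \<alpha>)"
    using assms(2) by (auto simp: kernel_scaled_def indicator_def fun_eq_iff field_simps zero_le_divide_iff)
  show "integrable lborel (\<lambda>z. indicator {0..} z * kernel_scaled \<Phi> \<alpha> z)"
    unfolding eq using lborel_integrable_real_affine[OF int, of "1 / \<alpha>" 0] assms(2) by simp
  show "(LINT z|lborel. indicator {0..} z * kernel_scaled \<Phi> \<alpha> z) = 1"
    unfolding eq using lborel_integral_real_affine[of "1 / \<alpha>" "\<lambda>z. indicator {0..} z * \<Phi> z" 0] one assms(2)
    by (simp add: field_simps)
qed (use assms in \<open>auto simp: kernel_ok_def kernel_scaled_def indicator_def divide_right_mono\<close>)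

lemma nl_avg_eq_avg:
  assumes "kernel_ok \<Phi>" "\<alpha> > 0"
  shows "nl_avg \<Phi> \<alpha> = averaging_kernel.avg (\<lambda>z. indicator {0..} z * kernel_scaled \<Phi> \<alpha> z)"
  unfolding averaging_kernel.avg_def[OF averaging_kernel_scaled[OF assms]] nl_avg_def[abs_def] set_lebesgue_integral_def
  by (simp add: fun_eq_iff mult.assoc)

subsection \<open>Time steps of Lipschitz weak solutions\<close>

lemma lipschitz_bound_continuous:
  fixes H :: "real \<Rightarrow> real"
  assumes "\<And>x y. x \<in> A \<Longrightarrow> y \<in> A \<Longrightarrow> \<bar>H x - H y\<bar> \<le> P * \<bar>x - y\<bar>"
  shows "continuous_on A H"
proof (rule lipschitz_on_continuous_on[of "\<bar>P\<bar>"], rule lipschitz_onI)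
  fix x y assume "x \<in> A" "y \<in> A"
  then have "\<bar>H x - H y\<bar> \<le> P * \<bar>x - y\<bar>" by (rule assms)
  also have "\<dots> \<le> \<bar>P\<bar> * \<bar>x - y\<bar>" by (rule mult_right_mono) auto
  finally show "dist (H x) (H y) \<le> \<bar>P\<bar> * dist x y" by (simp add: dist_real_def)
qed simp

text \<open>The translate \<open>e (x - a)\<close> is a probability density on
  \<open>[a, a + \<delta>]\<close>, where \<open>H\<close> differs from \<open>H a\<close> by at
  most \<open>P * \<delta>\<close>.\<close>

lemma mollifier_lipschitz:
  fixes H e :: "real \<Rightarrow> real"
  assumes H: "\<And>x y. \<bar>H x - H y\<bar> \<le> P * \<bar>x - y\<bar>"
    and e: "\<And>x. isCont e x" "\<And>x. e x \<ge> 0" "\<And>x. x \<notin> {0..\<delta>} \<Longrightarrow> e x = 0" "integral\<^sup>L lborel e = 1"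
  shows "integrable lborel (\<lambda>x. H x * e (x - a))"
    and "\<bar>(LINT x|lborel. H x * e (x - a)) - H a\<bar> \<le> P * \<delta>"
proof -
  have P: "P \<ge> 0" using H[of 0 1] by simp
  have H_cont: "continuous_on UNIV H"
    by (rule lipschitz_bound_continuous) (rule H)
  have "continuous_on UNIV e"
    using e(1) continuous_at_imp_continuous_on by blast
  then have e_cont: "continuous_on UNIV (\<lambda>x. e (x - a))"
    by (rule continuous_on_compose2) (auto intro: continuous_intros)
  have supp: "e (x - a) = 0" if "x \<notin> {a..a + \<delta>}" for x
    using e(3)[of "x - a"] that by auto
  show int: "integrable lborel (\<lambda>x. H x * e (x - a))"
    by (rule integrable_continuous_compact_support[of _ a "a + \<delta>"])
      (use supp in \<open>auto intro!: continuous_intros H_cont e_cont\<close>)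
  have e_int: "integrable lborel (\<lambda>x. e (x - a))"
    by (rule integrable_continuous_compact_support[OF e_cont supp])
  have e_one: "(LINT x|lborel. e (x - a)) = 1"
    using lborel_integral_real_affine[of 1 e "- a"] e(4) by simp
  have "(LINT x|lborel. H x * e (x - a)) - H a = (LINT x|lborel. (H x - H a) * e (x - a))"
    unfolding left_diff_distrib
    by (subst Bochner_Integration.integral_diff[OF int]) (use e_int e_one in auto)
  also have "\<bar>\<dots>\<bar> \<le> (LINT x|lborel. \<bar>(H x - H a) * e (x - a)\<bar>)"
    by (rule integral_abs_bound)
  also have "\<dots> \<le> (LINT x|lborel. (P * \<delta>) * e (x - a))"
  proof (rule integral_mono)
    show "integrable lborel (\<lambda>x. \<bar>(H x - H a) * e (x - a)\<bar>)"
      unfolding left_diff_distrib using int e_int by auto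
    show "\<bar>(H x - H a) * e (x - a)\<bar> \<le> (P * \<delta>) * e (x - a)" for x
    proof (cases "x \<in> {a..a + \<delta>}")
      case True
      have "\<bar>H x - H a\<bar> \<le> P * \<delta>"
        using H[of x a] True P by (intro order_trans[OF H[of x a]] mult_left_mono) auto
      then show ?thesis using e(2) by (simp add: abs_mult mult_right_mono)
    qed (simp add: supp)
  qed (use e_int in auto)
  also have "\<dots> = P * \<delta>" using e_one by simp
  finally show "\<bar>(LINT x|lborel. H x * e (x - a)) - H a\<bar> \<le> P * \<delta>" .
qed

text \<open>There are two errors. On the support of the plateau, of length at most
  \<open>2 * h\<close>, \<open>D\<close> varies by at most \<open>2 * L * h\<close>, and the plateau
  has mass at most \<open>2 * h\<close>; this gives the quadratic term. The mass differs from
  \<open>h\<close> by at most \<delta>, which gives the other term.\<close>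

lemma smooth_plateau_integral:
  fixes D S :: "real \<Rightarrow> real"
  assumes D: "\<And>x y. \<bar>D x - D y\<bar> \<le> L * \<bar>x - y\<bar>"
    and S: "mono S" "\<And>x. x \<le> 0 \<Longrightarrow> S x = 0" "\<And>x. x \<ge> \<delta> \<Longrightarrow> S x = 1" "continuous_on UNIV S"
    and \<delta>: "0 < \<delta>" "\<delta> \<le> h"
  shows "\<bar>(LINT x|lborel. D x * (S (x - z) - S (x - (z + h)))) - h * D z\<bar> \<le> 4 * L * h\<^sup>2 + \<bar>D z\<bar> * \<delta>"
proof -
  define \<psi> where "\<psi> x = S (x - z) - S (x - (z + h))" for x
  have L: "L \<ge> 0" using D[of 0 1] by simp
  have D_cont: "continuous_on UNIV D"
    by (rule lipschitz_bound_continuous) (rule D)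
  have \<psi>_cont: "continuous_on UNIV \<psi>" unfolding \<psi>_def
    by (intro continuous_intros continuous_on_compose2[OF S(4)]) auto
  have S01: "0 \<le> S x" "S x \<le> 1" for x
    using S(2)[of "min x 0"] S(3)[of "max x \<delta>"] monoD[OF S(1), of "min x 0" x] monoD[OF S(1), of x "max x \<delta>"]
    by auto
  have \<psi>_nonneg: "\<psi> x \<ge> 0" for x
    using monoD[OF S(1), of "x - (z + h)" "x - z"] \<delta> by (simp add: \<psi>_def)
  have \<psi>_supp: "\<psi> x = 0" if "x \<notin> {z..z + h + \<delta>}" for x
    using that S(2)[of "x - z"] S(2)[of "x - (z + h)"] S(3)[of "x - z"] S(3)[of "x - (z + h)"] \<delta>
    by (auto simp: \<psi>_def)
  have \<psi>_int: "integrable lborel \<psi>"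
    by (rule integrable_continuous_compact_support[OF \<psi>_cont \<psi>_supp])
  have D\<psi>_int: "integrable lborel (\<lambda>x. D x * \<psi> x)"
    by (rule integrable_continuous_compact_support[of _ z "z + h + \<delta>"])
      (use \<psi>_supp in \<open>auto intro!: continuous_intros D_cont \<psi>_cont\<close>)
  have "(LINT x|lborel. \<psi> x) \<le> (LINT x|lborel. indicator {z..z + h + \<delta>} x)"
  proof (rule integral_mono[OF \<psi>_int])
    show "\<psi> x \<le> indicator {z..z + h + \<delta>} x" for x
      using \<psi>_supp[of x] S01[of "x - z"] S01[of "x - (z + h)"] by (auto simp: \<psi>_def split: split_indicator)
  qed (use \<delta> in auto)
  then have upper: "(LINT x|lborel. \<psi> x) \<le> h + \<delta>" using \<delta> by simp
  have "(LINT x|lborel. indicator {z + \<delta>..z + h} x) \<le> (LINT x|lborel. \<psi> x)"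
  proof (rule integral_mono[OF _ \<psi>_int])
    show "indicator {z + \<delta>..z + h} x \<le> \<psi> x" for x
      using \<psi>_nonneg[of x] S(2)[of "x - (z + h)"] S(3)[of "x - z"]
      by (auto simp: \<psi>_def split: split_indicator)
  qed (use \<delta> in auto)
  then have lower: "h - \<delta> \<le> (LINT x|lborel. \<psi> x)" using \<delta> by simp
  have "(LINT x|lborel. D x * \<psi> x) - D z * (LINT x|lborel. \<psi> x) = (LINT x|lborel. (D x - D z) * \<psi> x)"
    unfolding left_diff_distrib
    by (subst Bochner_Integration.integral_diff[OF D\<psi>_int]) (use \<psi>_int in auto)
  also have "\<bar>\<dots>\<bar> \<le> (LINT x|lborel. \<bar>(D x - D z) * \<psi> x\<bar>)"
    by (rule integral_abs_bound)
  also have "\<dots> \<le> (LINT x|lborel. (L * (2 * h)) * \<psi> x)"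
  proof (rule integral_mono)
    show "integrable lborel (\<lambda>x. \<bar>(D x - D z) * \<psi> x\<bar>)"
      unfolding left_diff_distrib using D\<psi>_int \<psi>_int by auto
    show "\<bar>(D x - D z) * \<psi> x\<bar> \<le> (L * (2 * h)) * \<psi> x" for x
    proof (cases "x \<in> {z..z + h + \<delta>}")
      case True
      then have "\<bar>D x - D z\<bar> \<le> L * (2 * h)"
        using L \<delta> by (intro order_trans[OF D[of x z]] mult_left_mono) auto
      then show ?thesis using \<psi>_nonneg by (simp add: abs_mult mult_right_mono)
    qed (simp add: \<psi>_supp)
  qed (use \<psi>_int in auto)
  also have "\<dots> = (L * (2 * h)) * (LINT x|lborel. \<psi> x)" by simp
  also have "\<dots> \<le> (L * (2 * h)) * (2 * h)"
    using upper \<delta> L by (intro mult_left_mono) auto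
  also have "\<dots> = 4 * L * h\<^sup>2" by (simp add: power2_eq_square)
  finally have 1: "\<bar>(LINT x|lborel. D x * \<psi> x) - D z * (LINT x|lborel. \<psi> x)\<bar> \<le> 4 * L * h\<^sup>2" .
  have "\<bar>D z * (LINT x|lborel. \<psi> x) - h * D z\<bar> = \<bar>D z\<bar> * \<bar>(LINT x|lborel. \<psi> x) - h\<bar>"
    by (simp flip: abs_mult add: algebra_simps)
  also have "\<dots> \<le> \<bar>D z\<bar> * \<delta>"
    using upper lower by (intro mult_left_mono) auto
  finally show ?thesis using 1 unfolding \<psi>_def by linarith
qed

section \<open>Increments of weak flows\<close>

text \<open>The weak formulation for time-independent test functions, for the solution \<open>X\<close> with the
  prescribed initial values at \<open>t = 0\<close> and the flux \<open>G\<close>.\<close>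

locale lipschitz_weak_flow =
  fixes X G :: "real \<Rightarrow> real \<Rightarrow> real" and L P Q :: real
  assumes weak: "\<And>T f f' R. T > 0 \<Longrightarrow> f \<in> smooth_funs \<Longrightarrow> (\<And>x. (f has_real_derivative f' x) (at x)) \<Longrightarrow>
      (\<And>x. \<bar>x\<bar> > R \<Longrightarrow> f x = 0) \<Longrightarrow>
      (LINT t:{0..T}|lborel. (LINT z|lborel. - (G z t * f' z))) = (LINT z|lborel. (X z T - X z 0) * f z)"
    and X_space: "\<And>x y t. t \<ge> 0 \<Longrightarrow> \<bar>X x t - X y t\<bar> \<le> L * \<bar>x - y\<bar>"
    and G_space: "\<And>x y t. t \<ge> 0 \<Longrightarrow> \<bar>G x t - G y t\<bar> \<le> P * \<bar>x - y\<bar>"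
    and G_time: "\<And>x s t. s \<ge> 0 \<Longrightarrow> t \<ge> 0 \<Longrightarrow> \<bar>G x s - G x t\<bar> \<le> Q * \<bar>s - t\<bar>"
begin

lemma G_time_continuous: "A \<subseteq> {0..} \<Longrightarrow> continuous_on A (G x)"
  by (rule lipschitz_bound_continuous[where P=Q], rule G_time) auto

text \<open>The derivative of a smoothed indicator of \<open>[z, z + h]\<close> is a mollifier at
  \<open>z\<close> minus one at \<open>z + h\<close>. Hence the flux term of the weak formulation is
  close to the time integral of \<open>G (z + h) r - G z r\<close>; each mollifier contributes at
  most \<open>P * \<delta>\<close> per unit of time.\<close>

lemma increment_from_0_approx:
  assumes T: "T > 0" and \<delta>: "0 < \<delta>" "\<delta> \<le> h"
  shows "\<bar>h * (X z T - X z 0) - integral {0..T} (\<lambda>r. G (z + h) r - G z r)\<bar>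
    \<le> 8 * L * h\<^sup>2 + (\<bar>X z T - X z 0\<bar> + 2 * P * T) * \<delta>"
proof -
  obtain S e where S: "S \<in> smooth_funs" "\<And>x. (S has_real_derivative e x) (at x)"
    "\<And>x. x \<le> 0 \<Longrightarrow> S x = 0" "\<And>x. x \<ge> \<delta> \<Longrightarrow> S x = 1" "mono S"
    and e: "\<And>x. isCont e x" "\<And>x. e x \<ge> 0" "\<And>x. x \<notin> {0..\<delta>} \<Longrightarrow> e x = 0" "integral\<^sup>L lborel e = 1"
    by (rule smooth_step[OF \<delta>(1)]) blast
  define f where "f x = S (1 * x + (- z)) + (-1) * S (1 * x + (- (z + h)))" for x
  define f' where "f' x = e (x - z) - e (x - (z + h))" for x
  define D where "D x = X x T - X x 0" for x
  have f_smooth: "f \<in> smooth_funs" unfolding f_def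
    by (rule smooth_funs.add[OF smooth_funs.affine[OF S(1)] smooth_funs.mult[OF smooth_funs.const smooth_funs.affine[OF S(1)]]])
  have S_shift: "((\<lambda>x. S (x - a)) has_real_derivative e (x - a)) (at x)" for a x
  proof -
    have "((\<lambda>x. x - a) has_real_derivative 1) (at x)"
      by (auto intro!: derivative_eq_intros)
    from DERIV_chain2[OF S(2) this] show ?thesis by simp
  qed
  have f_eq: "f = (\<lambda>x. S (x - z) - S (x - (z + h)))" by (simp add: f_def fun_eq_iff algebra_simps)
  have f_deriv: "(f has_real_derivative f' x) (at x)" for x
    unfolding f_eq f'_def by (intro DERIV_diff S_shift)
  have f_supp: "f x = 0" if "\<bar>x\<bar> > \<bar>z\<bar> + 2 * h" for x
    using that S(3)[of "x - z"] S(3)[of "x - (z + h)"] S(4)[of "x - z"] S(4)[of "x - (z + h)"] \<delta>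
    unfolding f_eq by (cases "x < 0") (auto simp: abs_if split: if_splits)
  have S_cont: "continuous_on UNIV S"
    using S(2) by (meson DERIV_isCont continuous_at_imp_continuous_on)
  \<comment> \<open>\<open>D\<close> is the difference of two time slices, which doubles the
    Lipschitz constant and turns the 4 of the plateau estimate into 8.\<close>
  have D_lip: "\<bar>D x - D y\<bar> \<le> (2 * L) * \<bar>x - y\<bar>" for x y
    using X_space[of T x y] X_space[of 0 x y] T by (simp add: D_def)
  have lhs: "\<bar>(LINT x|lborel. D x * f x) - h * D z\<bar> \<le> 8 * L * h\<^sup>2 + \<bar>D z\<bar> * \<delta>"
    using smooth_plateau_integral[OF D_lip S(5,3,4) S_cont \<delta>, of z] unfolding f_eq by simp
  define m where "m a r = (LINT x|lborel. G x r * e (x - a))" for a r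
  note moll = mollifier_lipschitz[OF G_space e, where \<delta>=\<delta>]
  \<comment> \<open>Continuity in time justifies passing from the Lebesgue integral to the
    Henstock-Kurzweil integral over \<open>{0..T}\<close>.\<close>
  have m_cont: "continuous_on {0..T} (m a)" for a
  proof (rule lipschitz_bound_continuous[where P=Q])
    fix r s assume rs: "r \<in> {0..T}" "s \<in> {0..T}"
    have e_int: "integrable lborel (\<lambda>x. e (x - a))"
      using mollifier_lipschitz(1)[of "\<lambda>_. 1" 0, OF _ e] by simp
    have "m a r - m a s = (LINT x|lborel. (G x r - G x s) * e (x - a))"
      unfolding left_diff_distrib m_def
      by (subst Bochner_Integration.integral_diff) (use moll(1) rs in auto)
    also have "\<bar>\<dots>\<bar> \<le> (LINT x|lborel. \<bar>(G x r - G x s) * e (x - a)\<bar>)"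
      by (rule integral_abs_bound)
    also have "\<dots> \<le> (LINT x|lborel. (Q * \<bar>r - s\<bar>) * e (x - a))"
    proof (rule integral_mono)
      show "integrable lborel (\<lambda>x. \<bar>(G x r - G x s) * e (x - a)\<bar>)"
        unfolding left_diff_distrib using moll(1) rs by auto
      show "\<bar>(G x r - G x s) * e (x - a)\<bar> \<le> (Q * \<bar>r - s\<bar>) * e (x - a)" for x
        using G_time[of r s x] rs e(2) by (simp add: abs_mult mult_right_mono)
    qed (use e_int in auto)
    also have "\<dots> = Q * \<bar>r - s\<bar>"
      using lborel_integral_real_affine[of 1 e "- a"] e(4) by simp
    finally show "\<bar>m a r - m a s\<bar> \<le> Q * \<bar>r - s\<bar>" .
  qed
  have inner: "(LINT x|lborel. - (G x r * f' x)) = m (z + h) r - m z r" if "r \<in> {0..T}" for r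
  proof -
    have "(\<lambda>x. - (G x r * f' x)) = (\<lambda>x. G x r * e (x - (z + h)) - G x r * e (x - z))"
      by (simp add: f'_def fun_eq_iff algebra_simps)
    then show ?thesis
      unfolding m_def using moll(1) that by (subst Bochner_Integration.integral_diff[symmetric]) auto
  qed
  have "(LINT x|lborel. D x * f x) = (LINT r:{0..T}|lborel. (LINT x|lborel. - (G x r * f' x)))"
    unfolding D_def by (rule weak[OF T f_smooth f_deriv f_supp, symmetric])
  also have "\<dots> = (LINT r:{0..T}|lborel. m (z + h) r - m z r)"
    by (rule set_lebesgue_integral_cong) (use inner in auto)
  also have "\<dots> = integral {0..T} (\<lambda>r. m (z + h) r - m z r)"
    by (rule set_borel_integral_eq_integral(2), rule borel_integrable_atLeastAtMost')
      (intro continuous_intros m_cont)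
  finally have weak': "(LINT x|lborel. D x * f x) = integral {0..T} (\<lambda>r. m (z + h) r - m z r)" .
  have "integral {0..T} (\<lambda>r. m (z + h) r - m z r) - integral {0..T} (\<lambda>r. G (z + h) r - G z r)
      = integral {0..T} (\<lambda>r. (m (z + h) r - m z r) - (G (z + h) r - G z r))"
    by (rule Henstock_Kurzweil_Integration.integral_diff[symmetric];
        intro integrable_continuous_real continuous_intros m_cont G_time_continuous) auto
  also have "\<bar>\<dots>\<bar> \<le> (2 * P * \<delta>) * (T - 0)"
    unfolding real_norm_def[symmetric]
  proof (rule integral_bound)
    show "norm ((m (z + h) r - m z r) - (G (z + h) r - G z r)) \<le> 2 * P * \<delta>" if "r \<in> {0..T}" for r
    proof -
      have "r \<ge> 0" using that by simp
      show ?thesis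
        using moll(2)[OF \<open>r \<ge> 0\<close>, of z] moll(2)[OF \<open>r \<ge> 0\<close>, of "z + h"] unfolding m_def by simp
    qed
  qed (use T in \<open>auto intro!: continuous_intros m_cont G_time_continuous\<close>)
  finally have "\<bar>integral {0..T} (\<lambda>r. m (z + h) r - m z r) - integral {0..T} (\<lambda>r. G (z + h) r - G z r)\<bar>
    \<le> 2 * P * T * \<delta>" by (simp add: mult_ac)
  with lhs weak' show ?thesis unfolding D_def by (simp add: algebra_simps)
qed

text \<open>Let \<delta> tend to 0 with \<open>h\<close> fixed. The case \<open>T = 0\<close> is
  separate because the weak formulation is stated for positive \<open>T\<close>.\<close>

lemma increment_from_0:
  assumes T: "T \<ge> 0" and h: "h > 0"
  shows "\<bar>h * (X z T - X z 0) - integral {0..T} (\<lambda>r. G (z + h) r - G z r)\<bar> \<le> 8 * L * h\<^sup>2"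
proof (cases "T = 0")
  case True
  have "L \<ge> 0" using X_space[of 0 0 1] by simp
  with True show ?thesis by simp
next
  case False
  let ?c = "\<bar>X z T - X z 0\<bar> + 2 * P * T"
  have "((\<lambda>\<delta>. 8 * L * h\<^sup>2 + ?c * \<delta>) \<longlongrightarrow> 8 * L * h\<^sup>2 + ?c * 0) (at_right 0)"
    by (intro tendsto_intros)
  moreover have "\<forall>\<^sub>F \<delta> in at_right 0.
      \<bar>h * (X z T - X z 0) - integral {0..T} (\<lambda>r. G (z + h) r - G z r)\<bar> \<le> 8 * L * h\<^sup>2 + ?c * \<delta>"
    unfolding eventually_at_right_field
    by (intro exI[of _ h]) (use h T False increment_from_0_approx in auto)
  ultimately show ?thesis
    using tendsto_lowerbound[of _ _ "at_right (0::real)"] by force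
qed

text \<open>The weak formulation always starts at time 0, so the increment from \<open>s\<close> to
  \<open>t\<close> is a difference of two increments from 0, which doubles the constant.\<close>

lemma increment:
  assumes "0 \<le> s" "s \<le> t" "h > 0"
  shows "\<bar>h * (X z t - X z s) - integral {s..t} (\<lambda>r. G (z + h) r - G z r)\<bar> \<le> 16 * L * h\<^sup>2"
proof -
  have "integral {0..s} (\<lambda>r. G (z + h) r - G z r) + integral {s..t} (\<lambda>r. G (z + h) r - G z r)
      = integral {0..t} (\<lambda>r. G (z + h) r - G z r)"
    by (rule Henstock_Kurzweil_Integration.integral_combine)
      (use assms in \<open>auto intro!: integrable_continuous_real continuous_intros G_time_continuous\<close>)
  then show ?thesis
    using increment_from_0[of s h z] increment_from_0[of t h z] assms by (simp add: algebra_simps)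
qed

text \<open>With \<open>h = \<tau>\<^sup>2\<close>, dividing the increment estimate by
  \<open>h\<close> leaves \<open>16 * L * \<tau>\<^sup>2\<close>. Freezing the flux at time
  \<open>t\<close> costs at most \<open>N * h * \<tau>\<close> over a time \<tau>, hence
  \<open>N * \<tau>\<^sup>2\<close> after the division. Both errors are quadratic and can be summed
  over a partition.\<close>

lemma time_step:
  assumes st: "0 \<le> s" "s < t" and N: "N \<ge> 0"
    and mixed: "\<And>r h. 0 \<le> r \<Longrightarrow> h \<ge> 0 \<Longrightarrow>
      \<bar>(G (z + h) r - G z r) - (G (z + h) t - G z t)\<bar> \<le> N * h * \<bar>r - t\<bar>"
  defines "\<tau> \<equiv> t - s"
  shows "\<bar>X z t - X z s - (G (z + \<tau>\<^sup>2) t - G z t) / \<tau>\<bar> \<le> (16 * L + N) * \<tau>\<^sup>2"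
proof -
  define h where "h = \<tau>\<^sup>2"
  have \<tau>: "\<tau> > 0" using st by (simp add: \<tau>_def)
  then have h: "h > 0" by (simp add: h_def)
  let ?d = "\<lambda>r. G (z + h) r - G z r"
  have cont: "continuous_on {s..t} ?d"
    using st by (intro continuous_intros G_time_continuous) auto
  have "integral {s..t} ?d - \<tau> * ?d t = integral {s..t} (\<lambda>r. ?d r - ?d t)"
    using st by (subst Henstock_Kurzweil_Integration.integral_diff)
      (auto intro: integrable_continuous_real cont simp: \<tau>_def)
  also have "\<bar>\<dots>\<bar> \<le> (N * h * \<tau>) * (t - s)"
    unfolding real_norm_def[symmetric]
  proof (rule integral_bound)
    show "norm (?d r - ?d t) \<le> N * h * \<tau>" if r: "r \<in> {s..t}" for r
    proof -
      have "\<bar>?d r - ?d t\<bar> \<le> N * h * \<bar>r - t\<bar>" using r st h by (intro mixed) auto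
      also have "\<dots> \<le> N * h * \<tau>" using r N h by (intro mult_left_mono) (auto simp: \<tau>_def)
      finally show ?thesis by simp
    qed
  qed (use st in \<open>auto intro!: continuous_intros cont\<close>)
  finally have "\<bar>integral {s..t} ?d - \<tau> * ?d t\<bar> \<le> N * h * h"
    by (simp add: \<tau>_def h_def power2_eq_square mult_ac)
  then have *: "\<bar>h * (X z t - X z s) - \<tau> * ?d t\<bar> \<le> h * ((16 * L + N) * h)"
    using increment[of s t h z] st h by (simp add: algebra_simps power2_eq_square)
  have "h * (X z t - X z s) - \<tau> * ?d t = h * (X z t - X z s - ?d t / \<tau>)"
    using \<tau> by (simp add: h_def power2_eq_square field_simps)
  then have "h * \<bar>X z t - X z s - ?d t / \<tau>\<bar> \<le> h * ((16 * L + N) * h)"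
    using * h by (simp add: abs_mult)
  then show ?thesis using h by (simp add: h_def)
qed

end

subsection \<open>Tent weights and the contraction estimate\<close>

text \<open>Over \<open>n\<close> equal steps the quadratic errors add up to
  \<open>C * T\<^sup>2 / n\<close>, which vanishes as \<open>n\<close> grows. Requiring
  \<open>n \<ge> T\<close> keeps the step length at most 1.\<close>

lemma bound_from_quadratic_increments:
  fixes E :: "real \<Rightarrow> real"
  assumes T: "T > 0"
    and step: "\<And>s t. 0 \<le> s \<Longrightarrow> s < t \<Longrightarrow> t \<le> T \<Longrightarrow> t - s \<le> 1 \<Longrightarrow> E t \<le> E s + A * (t - s) + C * (t - s)\<^sup>2"
  shows "E T \<le> E 0 + A * T"
proof -
  have bound: "E T \<le> E 0 + A * T + C * T\<^sup>2 / real n" if n: "real n \<ge> T" for n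
  proof -
    have n0: "n > 0" using n T by (cases n) auto
    define d where "d = T / n"
    have d: "d > 0" "d \<le> 1" using n T n0 by (auto simp: d_def)
    have "E (i * d) \<le> E 0 + real i * (A * d + C * d\<^sup>2)" if "i \<le> n" for i
      using that
    proof (induction i)
      case (Suc i)
      have "real (Suc i) * d \<le> real n * d" using Suc.prems d by (intro mult_right_mono) auto
      also have "\<dots> = T" using n0 by (simp add: d_def)
      finally have "E (real (Suc i) * d) \<le> E (i * d) + A * (real (Suc i) * d - i * d) + C * (real (Suc i) * d - i * d)\<^sup>2"
        using d by (intro step) (auto simp: algebra_simps)
      moreover have "real (Suc i) * d - i * d = d" by (simp add: algebra_simps)
      ultimately show ?case using Suc by (simp add: algebra_simps)
    qed simp
    from this[of n] have "E T \<le> E 0 + real n * (A * d + C * d\<^sup>2)" using n0 by (simp add: d_def)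
    also have "real n * (A * d + C * d\<^sup>2) = A * T + C * T\<^sup>2 / n"
      using n0 by (simp add: d_def power2_eq_square field_simps)
    finally show ?thesis by simp
  qed
  have "(\<lambda>n. E 0 + A * T + C * T\<^sup>2 / real n) \<longlonglongrightarrow> E 0 + A * T + 0"
    by (intro tendsto_add tendsto_const lim_const_over_n)
  moreover have "\<forall>\<^sub>F n in sequentially. E T \<le> E 0 + A * T + C * T\<^sup>2 / real n"
    using eventually_ge_at_top[of "nat \<lceil>T\<rceil>"] by eventually_elim (rule bound, linarith)
  ultimately show ?thesis using tendsto_lowerbound by force
qed

section \<open>Tent weights and transport estimates\<close>

definition tent :: "real \<Rightarrow> real \<Rightarrow> real" where
  "tent R z = max 0 (1 - \<bar>z\<bar> / R)"

lemma tent_continuous: "R > 0 \<Longrightarrow> continuous_on A (\<lambda>z. tent R (f z))" if "continuous_on A f"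
  unfolding tent_def by (intro continuous_intros that) auto

lemma tent_nonneg: "tent R z \<ge> 0"
  by (simp add: tent_def)

lemma tent_le_1: "R > 0 \<Longrightarrow> tent R z \<le> 1"
  by (simp add: tent_def)

lemma tent_support: "R > 0 \<Longrightarrow> z \<notin> {-R..R} \<Longrightarrow> tent R z = 0"
  by (auto simp: tent_def max_def field_simps abs_if split: if_splits)

lemma tent_shift_le: "R > 0 \<Longrightarrow> h \<ge> 0 \<Longrightarrow> tent R (z - h) - tent R z \<le> h / R"
proof -
  assume R: "R > 0" "h \<ge> 0"
  have "\<bar>z\<bar> / R \<le> (\<bar>z - h\<bar> + h) / R" using R by (intro divide_right_mono) auto
  moreover have "h / R \<ge> 0" using R by simp
  ultimately show ?thesis unfolding tent_def add_divide_distrib by (auto simp: max_def)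
qed

lemma tent_mult_integrable:
  assumes "R > 0" "continuous_on UNIV f"
  shows "integrable lborel (\<lambda>z. tent R z * f z)"
  by (rule integrable_continuous_compact_support[of _ "-R" R])
    (use assms tent_support in \<open>auto intro!: continuous_intros tent_continuous\<close>)

lemma tent_integral_le: "R > 0 \<Longrightarrow> integral\<^sup>L lborel (tent R) \<le> 2 * R"
proof -
  assume R: "R > 0"
  have "integral\<^sup>L lborel (tent R) \<le> (LINT z|lborel. indicator {-R..R} z)"
  proof (rule integral_mono)
    show "integrable lborel (tent R)"
      using tent_mult_integrable[OF R, of "\<lambda>_. 1"] by simp
    show "tent R z \<le> indicator {-R..R} z" for z
      using tent_support[OF R] tent_le_1[OF R] by (auto split: split_indicator)
  qed (use R in auto)
  then show ?thesis using R by simp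
qed

text \<open>Translation invariance moves the shift from \<open>f\<close> onto the tent, whose
  increment is at most \<open>h / R\<close>.\<close>

lemma tent_summation_by_parts:
  assumes R: "R > 0" and h: "h \<ge> 0" and f: "continuous_on UNIV f"
  shows "integrable lborel (\<lambda>z. (tent R (z - h) - tent R z) * f z)"
    and "(LINT z|lborel. tent R z * (f (z + h) - f z)) = (LINT z|lborel. (tent R (z - h) - tent R z) * f z)"
proof -
  have fh: "continuous_on UNIV (\<lambda>z. f (z + h))"
    by (rule continuous_on_compose2[OF f]) (auto intro: continuous_intros)
  have shift: "integrable lborel (\<lambda>z. tent R (z - h) * f z)"
    by (rule integrable_continuous_compact_support[of _ "-R + h" "R + h"])
      (use R tent_support[of R "_ - h"] in \<open>auto intro!: continuous_intros tent_continuous f\<close>)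
  note int = tent_mult_integrable[OF R f]
  show "integrable lborel (\<lambda>z. (tent R (z - h) - tent R z) * f z)"
    unfolding left_diff_distrib by (rule Bochner_Integration.integrable_diff[OF shift int])
  have "(LINT z|lborel. tent R z * (f (z + h) - f z))
      = (LINT z|lborel. tent R z * f (z + h)) - (LINT z|lborel. tent R z * f z)"
    unfolding right_diff_distrib
    by (rule Bochner_Integration.integral_diff[OF tent_mult_integrable[OF R fh] int])
  also have "(LINT z|lborel. tent R z * f (z + h)) = (LINT z|lborel. tent R (z - h) * f z)"
    using lborel_integral_real_affine[of 1 "\<lambda>z. tent R (z - h) * f z" h] by (simp add: add.commute)
  also have "\<dots> - (LINT z|lborel. tent R z * f z) = (LINT z|lborel. (tent R (z - h) - tent R z) * f z)"
    unfolding left_diff_distrib by (rule Bochner_Integration.integral_diff[OF shift int, symmetric])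
  finally show "(LINT z|lborel. tent R z * (f (z + h) - f z)) = (LINT z|lborel. (tent R (z - h) - tent R z) * f z)" .
qed

text \<open>The increment of the tent is at most \<open>h / R\<close> everywhere. Outside
  \<open>{-R..R + h}\<close>, an interval of length \<open>2 * R + h\<close>, the shifted tent
  vanishes and the integrand is not positive. The bound does not decay in \<open>R\<close>; it
  serves the crude estimate.\<close>

lemma tent_transport_le_bounded:
  assumes R: "R > 0" and h: "h \<ge> 0" and f: "continuous_on UNIV f" "\<And>z. 0 \<le> f z" "\<And>z. f z \<le> M"
  shows "(LINT z|lborel. tent R z * (f (z + h) - f z)) \<le> h * (M * (2 * R + h) / R)"
proof -
  have "(LINT z|lborel. (tent R (z - h) - tent R z) * f z) \<le> (LINT z|lborel. (h / R * M) * indicator {-R..R + h} z)"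
  proof (rule integral_mono)
    show "(tent R (z - h) - tent R z) * f z \<le> (h / R * M) * indicator {-R..R + h} z" for z
    proof (cases "z \<in> {-R..R + h}")
      case True
      then show ?thesis
        using mult_mono[OF tent_shift_le[OF R h, of z] f(3)[of z] _ f(2)] R h by simp
    next
      case False
      then have "tent R (z - h) = 0" using tent_support[OF R, of "z - h"] h by auto
      then show ?thesis
        using False tent_nonneg[of R z] f(2)[of z] by simp
    qed
  qed (use R h tent_summation_by_parts(1)[OF R h f(1)] in auto)
  also have "\<dots> = h * (M * (2 * R + h) / R)" using R h by simp
  finally show ?thesis unfolding tent_summation_by_parts(2)[OF R h f(1)] .
qed

text \<open>Integrating the slope bound \<open>h / R\<close> against an integrable \<open>f\<close>
  gives a bound that vanishes as \<open>R\<close> grows.\<close>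

lemma tent_transport_le_integrable:
  assumes R: "R > 0" and h: "h \<ge> 0" and f: "continuous_on UNIV f" "\<And>z. 0 \<le> f z" "integrable lborel f"
  shows "(LINT z|lborel. tent R z * (f (z + h) - f z)) \<le> h * (integral\<^sup>L lborel f / R)"
proof -
  have "(LINT z|lborel. (tent R (z - h) - tent R z) * f z) \<le> (LINT z|lborel. h / R * f z)"
    by (rule integral_mono[OF tent_summation_by_parts(1)[OF R h f(1)]])
      (use f(3) mult_right_mono[OF tent_shift_le[OF R h] f(2)] in auto)
  then show ?thesis unfolding tent_summation_by_parts(2)[OF R h f(1)] by simp
qed

text \<open>Monotone convergence along the radii \<open>n + 1\<close>, all admissible since they are
  at least 1. The term \<open>C / R\<close> disappears in the limit, which is how the transport
  error is removed.\<close>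

lemma L1_bound_from_tents:
  fixes f :: "real \<Rightarrow> real"
  assumes f: "continuous_on UNIV f" and B: "\<And>R. R \<ge> 1 \<Longrightarrow> (LINT z|lborel. tent R z * \<bar>f z\<bar>) \<le> B + C / R"
    and C: "C \<ge> 0"
  shows "integrable lborel f" "(LINT z|lborel. \<bar>f z\<bar>) \<le> B"
proof -
  define F where "F n z = tent (real n + 1) z * \<bar>f z\<bar>" for n z
  have F_int: "integrable lborel (F n)" for n
    unfolding F_def by (rule tent_mult_integrable) (auto intro!: continuous_intros f)
  have F_mono: "F m z \<le> F n z" if "m \<le> n" for m n z
  proof -
    have "\<bar>z\<bar> / (real n + 1) \<le> \<bar>z\<bar> / (real m + 1)" using that by (intro divide_left_mono) auto
    then show ?thesis unfolding F_def tent_def by (intro mult_right_mono) auto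
  qed
  have lim1: "(\<lambda>n. \<bar>z\<bar> / (real n + 1)) \<longlonglongrightarrow> 0" for z :: real
    using LIMSEQ_Suc[OF lim_const_over_n[of "\<bar>z\<bar>"]] by (simp add: add.commute)
  have F_lim: "(\<lambda>n. F n z) \<longlonglongrightarrow> \<bar>f z\<bar>" for z
  proof -
    have "(\<lambda>n. max 0 (1 - \<bar>z\<bar> / (real n + 1)) * \<bar>f z\<bar>) \<longlonglongrightarrow> max 0 (1 - 0) * \<bar>f z\<bar>"
      by (intro tendsto_intros lim1)
    then show ?thesis by (simp add: F_def tent_def)
  qed
  have le: "integral\<^sup>L lborel (F n) \<le> B + C / (real n + 1)" for n
    unfolding F_def by (rule B) simp
  have "integral\<^sup>L lborel (F n) \<le> B + C" for n
  proof -
    have "C / (real n + 1) \<le> C" using C by (simp add: field_simps)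
    with le[of n] show ?thesis by linarith
  qed
  moreover have "incseq (\<lambda>n. integral\<^sup>L lborel (F n))"
    by (intro monoI integral_mono F_int F_mono)
  ultimately obtain I where I: "(\<lambda>n. integral\<^sup>L lborel (F n)) \<longlonglongrightarrow> I"
    using incseq_convergent by blast
  have "I \<le> B + 0"
  proof (rule LIMSEQ_le[OF I])
    have "(\<lambda>n. \<bar>C\<bar> / (real n + 1)) \<longlonglongrightarrow> 0" by (rule lim1)
    then show "(\<lambda>n. B + C / (real n + 1)) \<longlonglongrightarrow> B + 0" using C by (intro tendsto_intros) simp
  qed (use le in blast)
  have meas: "f \<in> borel_measurable borel" by (rule borel_measurable_continuous_onI[OF f])
  have mc: "integrable lborel (\<lambda>z. \<bar>f z\<bar>)" "(LINT z|lborel. \<bar>f z\<bar>) = I"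
    by (rule integrable_monotone_convergence[of lborel F], insert F_int F_mono F_lim I meas, auto simp: mono_def)
      (rule integral_monotone_convergence[of lborel F], insert F_int F_mono F_lim I meas, auto simp: mono_def)
  show "integrable lborel f" using mc(1) meas by (simp add: integrable_abs_iff)
  show "(LINT z|lborel. \<bar>f z\<bar>) \<le> B" using mc(2) \<open>I \<le> B + 0\<close> by simp
qed

section \<open>The contraction estimate in L1\<close>

text \<open>\<open>u\<close> is the difference of two solutions and \<open>g\<close> the difference of their fluxes before
  averaging; \<open>sgn_g\<close> expresses that the flux is non-decreasing.\<close>

locale sign_coupled_flow = averaging_kernel k for k +
  fixes u g :: "real \<Rightarrow> real \<Rightarrow> real" and M Lg c K :: real
  assumes u_cont: "\<And>t. t \<ge> 0 \<Longrightarrow> continuous_on UNIV (\<lambda>z. u z t)"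
    and g_bound: "\<And>z t. t > 0 \<Longrightarrow> \<bar>g z t\<bar> \<le> M"
    and g_lip: "\<And>x y t. t > 0 \<Longrightarrow> \<bar>g x t - g y t\<bar> \<le> Lg * \<bar>x - y\<bar>"
    and sgn_g: "\<And>z t. t > 0 \<Longrightarrow> sgn (u z t) * g z t = \<bar>g z t\<bar>"
    and g_le: "\<And>z t. t > 0 \<Longrightarrow> \<bar>g z t\<bar> \<le> K * \<bar>u z t\<bar>"
    and time_step: "\<And>z s t. 0 \<le> s \<Longrightarrow> s < t \<Longrightarrow>
      \<bar>u z t - u z s - (avg (\<lambda>x. g x t) (z + (t - s)\<^sup>2) - avg (\<lambda>x. g x t) z) / (t - s)\<bar> \<le> c * (t - s)\<^sup>2"
    and u0_int: "integrable lborel (\<lambda>z. u z 0)"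
    and K_nonneg: "K \<ge> 0"
begin

lemma g_cont: "t > 0 \<Longrightarrow> continuous_on UNIV (\<lambda>x. g x t)"
  by (rule lipschitz_bound_continuous[where P=Lg]) (rule g_lip)

lemma g_measurable: "t > 0 \<Longrightarrow> (\<lambda>x. g x t) \<in> borel_measurable borel"
  by (rule borel_measurable_continuous_onI) (rule g_cont)

definition flux_avg :: "real \<Rightarrow> real \<Rightarrow> real" where
  "flux_avg t = avg (\<lambda>x. \<bar>g x t\<bar>)"

lemma flux_avg_nonneg: "flux_avg t z \<ge> 0"
  unfolding flux_avg_def avg_def using k_nonneg by (intro Bochner_Integration.integral_nonneg) simp

lemma flux_avg_le: "t > 0 \<Longrightarrow> flux_avg t z \<le> M"
  using avg_abs_le[of "\<lambda>x. \<bar>g x t\<bar>" M z] g_measurable[of t] g_bound[of t] unfolding flux_avg_def by fastforce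

lemma flux_avg_cont: "t > 0 \<Longrightarrow> continuous_on UNIV (flux_avg t)"
  unfolding flux_avg_def
  by (rule lipschitz_bound_continuous, rule avg_lipschitz[of _ M]) (use g_measurable g_bound in auto)

text \<open>Multiplying \<open>time_step\<close> by \<open>sgn (u z t)\<close> costs nothing: \<open>\<bar>g\<bar> - sgn (u z t) * g\<close> is
  non-negative and vanishes at \<open>z\<close>, so its average grows, up to second order, when shifted.\<close>

lemma abs_time_step:
  assumes st: "0 \<le> s" "s < t" "t - s \<le> 1"
  shows "\<bar>u z t\<bar> \<le> \<bar>u z s\<bar> + (flux_avg t (z + (t - s)\<^sup>2) - flux_avg t z) / (t - s) + (c + 2 * k 0 * Lg) * (t - s)\<^sup>2"
proof -
  define \<tau> where "\<tau> = t - s"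
  define h where "h = \<tau>\<^sup>2"
  define \<sigma> where "\<sigma> = sgn (u z t)"
  define q where "q x = \<bar>g x t\<bar> - \<sigma> * g x t" for x
  have t: "t > 0" and \<tau>: "\<tau> > 0" "\<tau> \<le> 1" using st by (auto simp: \<tau>_def)
  have h: "h > 0" using \<tau> by (simp add: h_def)
  have Lg: "Lg \<ge> 0" using g_lip[OF t, of 0 1] by simp
  have \<sigma>: "\<bar>\<sigma>\<bar> \<le> 1" by (simp add: \<sigma>_def sgn_if)
  have \<sigma>_le: "\<bar>\<sigma> * x\<bar> \<le> \<bar>x\<bar>" for x using \<sigma> by (simp add: abs_mult mult_left_le_one_le)
  note g_meas = g_measurable[OF t]
  have avg_q: "avg q x = flux_avg t x - \<sigma> * avg (\<lambda>x. g x t) x" for x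
  proof -
    have "avg q x = flux_avg t x - avg (\<lambda>x. \<sigma> * g x t) x"
      unfolding q_def flux_avg_def
      by (rule avg_diff[where M=M and N=M]) (use g_meas g_bound[OF t] order_trans[OF \<sigma>_le g_bound[OF t]] in auto)
    also have "avg (\<lambda>x. \<sigma> * g x t) x = \<sigma> * avg (\<lambda>x. g x t) x"
      unfolding avg_def by (simp add: mult.left_commute)
    finally show ?thesis .
  qed
  have "avg q (z + h) - avg q z \<ge> - (k 0 * h * (2 * Lg * h))"
  proof (rule avg_shift_ge[where M="2 * M"])
    show "q \<in> borel_measurable borel" unfolding q_def using g_meas by measurable
    show "q x \<ge> 0" for x using \<sigma>_le[of "g x t"] unfolding q_def by linarith
    show "\<bar>q x\<bar> \<le> 2 * M" for x
      using \<sigma>_le[of "g x t"] g_bound[OF t, of x] unfolding q_def by linarith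
    \<comment> \<open>\<open>q\<close> vanishes at \<open>z\<close>, the point where the sign is
      taken, and each of its two terms changes by at most \<open>Lg * h\<close> on the interval;
      hence the factor 2.\<close>
    show "q x \<le> 2 * Lg * h" if "z \<le> x" "x < z + h" for x
    proof -
      have "q z = 0" using sgn_g[OF t, of z] by (simp add: q_def \<sigma>_def)
      moreover have "\<bar>\<sigma> * g x t - \<sigma> * g z t\<bar> \<le> \<bar>g x t - g z t\<bar>"
        using \<sigma>_le[of "g x t - g z t"] by (simp add: algebra_simps)
      ultimately have "q x \<le> 2 * \<bar>g x t - g z t\<bar>"
        using abs_triangle_ineq2[of "g x t" "g z t"] abs_ge_minus_self[of "\<sigma> * g x t - \<sigma> * g z t"]
        unfolding q_def by argo
      also have "\<dots> \<le> 2 * (Lg * \<bar>x - z\<bar>)" using g_lip[OF t, of x z] by simp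
      also have "\<dots> \<le> 2 * (Lg * h)" using that Lg by (intro mult_left_mono) auto
      finally show ?thesis by simp
    qed
  qed (use h in auto)
  then have "\<sigma> * (avg (\<lambda>x. g x t) (z + h) - avg (\<lambda>x. g x t) z) \<le> flux_avg t (z + h) - flux_avg t z + 2 * k 0 * Lg * h * h"
    unfolding avg_q by (simp add: algebra_simps)
  then have "\<sigma> * (avg (\<lambda>x. g x t) (z + h) - avg (\<lambda>x. g x t) z) / \<tau> \<le> (flux_avg t (z + h) - flux_avg t z + 2 * k 0 * Lg * h * h) / \<tau>"
    using \<tau> by (intro divide_right_mono) auto
  also have "\<dots> = (flux_avg t (z + h) - flux_avg t z) / \<tau> + 2 * k 0 * Lg * h * \<tau>"
    using \<tau> by (simp add: h_def power2_eq_square field_simps)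
  \<comment> \<open>Here the restriction to steps of length at most 1 enters.\<close>
  also have "2 * k 0 * Lg * h * \<tau> \<le> 2 * k 0 * Lg * h"
    using mult_left_mono[OF \<tau>(2), of "2 * k 0 * Lg * h"] k_nonneg[of 0] Lg h by simp
  finally have flux: "\<sigma> * ((avg (\<lambda>x. g x t) (z + h) - avg (\<lambda>x. g x t) z) / \<tau>) \<le> (flux_avg t (z + h) - flux_avg t z) / \<tau> + 2 * k 0 * Lg * h"
    by simp
  define r where "r = u z t - u z s - (avg (\<lambda>x. g x t) (z + h) - avg (\<lambda>x. g x t) z) / \<tau>"
  have r: "\<bar>r\<bar> \<le> c * h" using time_step[of s t z] st unfolding r_def h_def \<tau>_def by simp
  have "\<bar>u z t\<bar> = \<sigma> * u z t" by (simp add: \<sigma>_def abs_sgn mult.commute)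
  also have "\<dots> = \<sigma> * u z s + \<sigma> * r + \<sigma> * ((avg (\<lambda>x. g x t) (z + h) - avg (\<lambda>x. g x t) z) / \<tau>)"
    by (simp add: r_def algebra_simps)
  also have "\<dots> \<le> \<bar>u z s\<bar> + c * h + ((flux_avg t (z + h) - flux_avg t z) / \<tau> + 2 * k 0 * Lg * h)"
    using \<sigma>_le[of "u z s"] \<sigma>_le[of r] r flux by linarith
  finally show ?thesis by (simp add: h_def \<tau>_def algebra_simps)
qed

text \<open>The pointwise inequality is multiplied by the tent and integrated. The transport bound
  \<open>(t - s)\<^sup>2 * B\<close> loses one power on division by \<open>t - s\<close>, and the
  quadratic error is multiplied by the mass of the tent, at most \<open>2 * R\<close>.\<close>

lemma tent_time_step:
  assumes st: "0 \<le> s" "s < t" "t - s \<le> 1" and R: "R > 0"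
    and B: "(LINT z|lborel. tent R z * (flux_avg t (z + (t - s)\<^sup>2) - flux_avg t z)) \<le> (t - s)\<^sup>2 * B"
  shows "(LINT z|lborel. tent R z * \<bar>u z t\<bar>) \<le> (LINT z|lborel. tent R z * \<bar>u z s\<bar>) + B * (t - s)
    + (\<bar>c + 2 * k 0 * Lg\<bar> * (2 * R)) * (t - s)\<^sup>2"
proof -
  define \<tau> where "\<tau> = t - s"
  define C where "C = \<bar>c + 2 * k 0 * Lg\<bar>"
  have t: "t > 0" and \<tau>: "\<tau> > 0" using st by (auto simp: \<tau>_def)
  have cu: "continuous_on UNIV (\<lambda>z. \<bar>u z r\<bar>)" if "r \<ge> 0" for r
    using u_cont[OF that] by (intro continuous_intros)
  have ca: "continuous_on UNIV (\<lambda>z. flux_avg t (z + \<tau>\<^sup>2) - flux_avg t z)"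
    by (intro continuous_intros flux_avg_cont[OF t] continuous_on_compose2[OF flux_avg_cont[OF t]]) auto
  have i1: "integrable lborel (\<lambda>z. tent R z * \<bar>u z s\<bar>)" "integrable lborel (\<lambda>z. tent R z * \<bar>u z t\<bar>)"
    by (rule tent_mult_integrable[OF R cu]; use st in simp)+
  have i2: "integrable lborel (\<lambda>z. tent R z * (flux_avg t (z + \<tau>\<^sup>2) - flux_avg t z))"
    by (rule tent_mult_integrable[OF R ca])
  have i3: "integrable lborel (tent R)"
    using tent_mult_integrable[OF R, of "\<lambda>_. 1"] by simp
  have "(LINT z|lborel. tent R z * \<bar>u z t\<bar>)
      \<le> (LINT z|lborel. tent R z * \<bar>u z s\<bar> + (tent R z * (flux_avg t (z + \<tau>\<^sup>2) - flux_avg t z)) / \<tau> + (C * \<tau>\<^sup>2) * tent R z)"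
  proof (rule integral_mono)
    fix z
    have "(c + 2 * k 0 * Lg) * \<tau>\<^sup>2 \<le> C * \<tau>\<^sup>2" unfolding C_def by (intro mult_right_mono) auto
    then have "\<bar>u z t\<bar> \<le> \<bar>u z s\<bar> + (flux_avg t (z + \<tau>\<^sup>2) - flux_avg t z) / \<tau> + C * \<tau>\<^sup>2"
      using abs_time_step[OF st, of z] unfolding \<tau>_def by linarith
    from mult_left_mono[OF this tent_nonneg[of R z]]
    show "tent R z * \<bar>u z t\<bar> \<le> tent R z * \<bar>u z s\<bar> + (tent R z * (flux_avg t (z + \<tau>\<^sup>2) - flux_avg t z)) / \<tau> + (C * \<tau>\<^sup>2) * tent R z"
      by (simp add: algebra_simps)
  qed (use i1 i2 i3 in auto)
  also have "\<dots> = (LINT z|lborel. tent R z * \<bar>u z s\<bar>) + (LINT z|lborel. tent R z * (flux_avg t (z + \<tau>\<^sup>2) - flux_avg t z)) / \<tau>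
      + (C * \<tau>\<^sup>2) * integral\<^sup>L lborel (tent R)"
    using i1 i2 i3 by simp
  also have "(LINT z|lborel. tent R z * (flux_avg t (z + \<tau>\<^sup>2) - flux_avg t z)) / \<tau> \<le> \<tau>\<^sup>2 * B / \<tau>"
    using B \<tau> unfolding \<tau>_def by (intro divide_right_mono) auto
  also have "\<tau>\<^sup>2 * B / \<tau> = B * \<tau>" using \<tau> by (simp add: power2_eq_square)
  also have "(C * \<tau>\<^sup>2) * integral\<^sup>L lborel (tent R) \<le> (C * \<tau>\<^sup>2) * (2 * R)"
    using tent_integral_le[OF R] by (intro mult_left_mono) (auto simp: C_def)
  finally show ?thesis by (simp add: C_def \<tau>_def mult_ac)
qed

lemma tent_u0_le: "R > 0 \<Longrightarrow> (LINT z|lborel. tent R z * \<bar>u z 0\<bar>) \<le> (LINT z|lborel. \<bar>u z 0\<bar>)"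
  using u_cont[of 0] u0_int tent_le_1[of R]
  by (intro integral_mono tent_mult_integrable) (auto intro!: continuous_intros mult_left_le_one_le tent_nonneg)

text \<open>\<open>R\<close> is fixed while the partition is refined, so the quadratic errors vanish
  although their constant grows with \<open>R\<close>.\<close>

lemma tent_bound:
  assumes T: "T > 0" and R: "R > 0"
    and B: "\<And>t h. 0 < t \<Longrightarrow> t \<le> T \<Longrightarrow> 0 \<le> h \<Longrightarrow> h \<le> 1 \<Longrightarrow>
      (LINT z|lborel. tent R z * (flux_avg t (z + h) - flux_avg t z)) \<le> h * B"
  shows "(LINT z|lborel. tent R z * \<bar>u z T\<bar>) \<le> (LINT z|lborel. \<bar>u z 0\<bar>) + B * T"
proof -
  have "(LINT z|lborel. tent R z * \<bar>u z T\<bar>) \<le> (LINT z|lborel. tent R z * \<bar>u z 0\<bar>) + B * T"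
  proof (rule bound_from_quadratic_increments[OF T])
    fix s t :: real assume st: "0 \<le> s" "s < t" "t \<le> T" "t - s \<le> 1"
    then have "(t - s)\<^sup>2 \<le> 1" by (simp add: power_le_one)
    with st show "(LINT z|lborel. tent R z * \<bar>u z t\<bar>) \<le> (LINT z|lborel. tent R z * \<bar>u z s\<bar>) + B * (t - s)
      + (\<bar>c + 2 * k 0 * Lg\<bar> * (2 * R)) * (t - s)\<^sup>2"
      by (intro tent_time_step R B) auto
  qed
  with tent_u0_le[OF R] show ?thesis by linarith
qed

lemma M_nonneg: "M \<ge> 0"
  using g_bound[of 1 0] by simp

text \<open>First pass, using only that the flux is bounded: for \<open>R \<ge> 1\<close> and
  \<open>h \<le> 1\<close> the factor \<open>(2 * R + h) / R\<close> is at most 3. The tent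
  integrals are then bounded uniformly in \<open>R\<close>, which yields integrability.\<close>

lemma L1_bound_crude:
  assumes T: "T > 0"
  shows "integrable lborel (\<lambda>z. u z T)" "(LINT z|lborel. \<bar>u z T\<bar>) \<le> (LINT z|lborel. \<bar>u z 0\<bar>) + 3 * M * T"
proof -
  have "(LINT z|lborel. tent R z * \<bar>u z T\<bar>) \<le> (LINT z|lborel. \<bar>u z 0\<bar>) + 3 * M * T + 0 / R" if R: "R \<ge> 1" for R
  proof -
    have "(LINT z|lborel. tent R z * \<bar>u z T\<bar>) \<le> (LINT z|lborel. \<bar>u z 0\<bar>) + (3 * M) * T"
    proof (rule tent_bound[OF T])
      fix t h :: real assume t: "0 < t" and h: "0 \<le> h" "h \<le> 1"
      have "(LINT z|lborel. tent R z * (flux_avg t (z + h) - flux_avg t z)) \<le> h * (M * (2 * R + h) / R)"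
        by (rule tent_transport_le_bounded) (use R h flux_avg_cont[OF t] flux_avg_nonneg flux_avg_le[OF t] in auto)
      also have "\<dots> \<le> h * (M * (3 * R) / R)"
        using R h M_nonneg by (intro mult_left_mono divide_right_mono) auto
      finally show "(LINT z|lborel. tent R z * (flux_avg t (z + h) - flux_avg t z)) \<le> h * (3 * M)"
        using R by (simp add: mult_ac)
    qed (use R in auto)
    then show ?thesis by simp
  qed
  from L1_bound_from_tents[OF u_cont this] T
  show "integrable lborel (\<lambda>z. u z T)" "(LINT z|lborel. \<bar>u z T\<bar>) \<le> (LINT z|lborel. \<bar>u z 0\<bar>) + 3 * M * T"
    by auto
qed

text \<open>Second pass: \<open>g\<close> is now integrable because it is dominated by
  \<open>K * \<bar>u\<bar>\<close>, so the transport term over \<open>[0, T]\<close> is at most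
  \<open>B * T / R\<close> and vanishes as \<open>R\<close> grows.\<close>

theorem L1_contraction:
  assumes T: "T > 0"
  shows "(LINT z|lborel. \<bar>u z T\<bar>) \<le> (LINT z|lborel. \<bar>u z 0\<bar>)"
proof -
  \<comment> \<open>\<open>K\<close> times the crude bound at the final time, which dominates the L1
    norm of \<open>flux_avg t\<close> for all \<open>t\<close> in \<open>(0, T]\<close>.\<close>
  define B where "B = K * ((LINT z|lborel. \<bar>u z 0\<bar>) + 3 * M * T)"
  have B: "B \<ge> 0" unfolding B_def using K_nonneg M_nonneg T by simp
  have flux_avg_L1: "integrable lborel (flux_avg t)" "integral\<^sup>L lborel (flux_avg t) \<le> B" if t: "0 < t" "t \<le> T" for t
  proof -
    note u_int = L1_bound_crude[OF t(1)]
    have g_int: "integrable lborel (\<lambda>z. \<bar>g z t\<bar>)"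
      by (rule Bochner_Integration.integrable_bound[of _ "\<lambda>z. K * u z t"])
        (use u_int g_measurable[OF t(1)] g_le[OF t(1)] K_nonneg in \<open>auto simp: abs_mult\<close>)
    show "integrable lborel (flux_avg t)" unfolding flux_avg_def by (rule avg_L1(1)[OF g_int])
    have "integral\<^sup>L lborel (flux_avg t) \<le> (LINT z|lborel. \<bar>g z t\<bar>)"
      using avg_L1(2)[OF g_int] flux_avg_nonneg[of t] unfolding flux_avg_def by simp
    also have "\<dots> \<le> (LINT z|lborel. K * \<bar>u z t\<bar>)"
      by (rule integral_mono) (use g_int u_int g_le[OF t(1)] in auto)
    also have "\<dots> = K * (LINT z|lborel. \<bar>u z t\<bar>)" by simp
    also have "\<dots> \<le> B"
      unfolding B_def
    proof (rule mult_left_mono[OF _ K_nonneg])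
      have "3 * M * t \<le> 3 * M * T" using t M_nonneg by (intro mult_left_mono) auto
      with u_int(2) show "(LINT z|lborel. \<bar>u z t\<bar>) \<le> (LINT z|lborel. \<bar>u z 0\<bar>) + 3 * M * T" by linarith
    qed
    finally show "integral\<^sup>L lborel (flux_avg t) \<le> B" .
  qed
  have "(LINT z|lborel. tent R z * \<bar>u z T\<bar>) \<le> (LINT z|lborel. \<bar>u z 0\<bar>) + (B * T) / R" if R: "R \<ge> 1" for R
  proof -
    have "(LINT z|lborel. tent R z * \<bar>u z T\<bar>) \<le> (LINT z|lborel. \<bar>u z 0\<bar>) + (B / R) * T"
    proof (rule tent_bound[OF T])
      fix t h :: real assume t: "0 < t" "t \<le> T" and h: "0 \<le> h" "h \<le> 1"
      have "(LINT z|lborel. tent R z * (flux_avg t (z + h) - flux_avg t z)) \<le> h * (integral\<^sup>L lborel (flux_avg t) / R)"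
        by (rule tent_transport_le_integrable) (use R h flux_avg_cont[OF t(1)] flux_avg_nonneg flux_avg_L1(1)[OF t] in auto)
      also have "\<dots> \<le> h * (B / R)"
        using R h flux_avg_L1(2)[OF t] by (intro mult_left_mono divide_right_mono) auto
      finally show "(LINT z|lborel. tent R z * (flux_avg t (z + h) - flux_avg t z)) \<le> h * (B / R)" .
    qed (use R in auto)
    then show ?thesis by simp
  qed
  from L1_bound_from_tents(2)[OF u_cont this] T B show ?thesis by simp
qed

end

subsection \<open>The nonlocal equation\<close>

text \<open>For arguments at least 1, the reciprocal stays in the compact interval
  \<open>[0, 1]\<close>, where the derivative of \<open>V\<close> is bounded, and taking reciprocals
  does not increase distances. Comparison with \<open>V 0\<close> gives boundedness.\<close>

lemma W_of_regular:
  assumes "flux_ok V"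
  obtains K M where "K \<ge> 0" "\<And>x y. x \<ge> 1 \<Longrightarrow> y \<ge> 1 \<Longrightarrow> \<bar>W_of V x - W_of V y\<bar> \<le> K * \<bar>x - y\<bar>"
    "\<And>x. x \<ge> 1 \<Longrightarrow> \<bar>W_of V x\<bar> \<le> M" "\<And>x y. x \<ge> 1 \<Longrightarrow> x \<le> y \<Longrightarrow> W_of V x \<le> W_of V y"
proof -
  obtain V' where V': "\<And>x. x \<ge> 0 \<Longrightarrow> (V has_real_derivative V' x) (at x within {0..})" "continuous_on {0..} V'"
    and anti: "\<And>x y. 0 \<le> x \<Longrightarrow> x \<le> y \<Longrightarrow> V y \<le> V x"
    using assms unfolding flux_ok_def by blast
  have "compact (V' ` {0..1})"
    by (intro compact_continuous_image continuous_on_subset[OF V'(2)]) auto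
  then have "bounded (V' ` {0..1})" by (rule compact_imp_bounded)
  then obtain K where K: "\<And>x. x \<in> {0..1} \<Longrightarrow> \<bar>V' x\<bar> \<le> K"
    unfolding bounded_iff real_norm_def by blast
  have K0: "K \<ge> 0" using K[of 0] by simp
  have V_lip: "\<bar>V x - V y\<bar> \<le> K * \<bar>x - y\<bar>" if "x \<in> {0..1}" "y \<in> {0..1}" for x y
    unfolding real_norm_def[symmetric]
    by (rule field_differentiable_bound[of "{0..1}" V V'])
      (use that K in \<open>auto intro!: has_field_derivative_subset[OF V'(1)]\<close>)
  have inv: "\<bar>1 / x - 1 / y\<bar> \<le> \<bar>x - y\<bar>" if "x \<ge> 1" "y \<ge> 1" for x y :: real
  proof -
    have "1 * 1 \<le> x * y" using that by (intro mult_mono) auto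
    then have "\<bar>x - y\<bar> * 1 \<le> \<bar>x - y\<bar> * (x * y)" by (intro mult_left_mono) auto
    moreover have "\<bar>1 / x - 1 / y\<bar> = \<bar>x - y\<bar> / (x * y)"
      using that by (simp add: diff_frac_eq abs_divide abs_mult abs_minus_commute)
    ultimately show ?thesis using that by (simp add: divide_le_eq)
  qed
  show ?thesis
  proof (rule that[OF K0])
    show "\<bar>W_of V x - W_of V y\<bar> \<le> K * \<bar>x - y\<bar>" if "x \<ge> 1" "y \<ge> 1" for x y
      unfolding W_of_def
      using V_lip[of "1 / x" "1 / y"] mult_left_mono[OF inv[OF that] K0] that by simp
    show "\<bar>W_of V x\<bar> \<le> \<bar>V 0\<bar> + K" if "x \<ge> 1" for x
    proof -
      have "K * (1 / x) \<le> K * 1" using that K0 by (intro mult_left_mono) auto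
      then show ?thesis
        using V_lip[of "1 / x" 0] that unfolding W_of_def by simp
    qed
    show "W_of V x \<le> W_of V y" if "x \<ge> 1" "x \<le> y" for x y
      unfolding W_of_def using that by (intro anti) (auto simp: frac_le)
  qed
qed

lemma BV_bounded_representative:
  assumes "BV f"
  obtains f' M where "f' \<in> borel_measurable borel" "\<And>x. \<bar>f' x\<bar> \<le> M" "AE x in lborel. f x = f' x"
proof -
  obtain g where g: "bounded_var g" "AE x in lborel. f x = g x" and f: "f \<in> borel_measurable borel"
    using assms unfolding BV_def by auto
  then obtain B where B: "\<And>n (x::nat \<Rightarrow> real). (\<forall>i<n. x i < x (Suc i)) \<Longrightarrow> (\<Sum>i<n. \<bar>g (x (Suc i)) - g (x i)\<bar>) \<le> B"
    unfolding bounded_var_def by blast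
  have var: "\<bar>g y - g x\<bar> \<le> B" if "x < y" for x y
    using B[of 1 "\<lambda>i. if i = 0 then x else y"] that by simp
  \<comment> \<open>Two-point partitions bound the oscillation; the empty partition gives
    \<open>0 \<le> B\<close> for the case \<open>x = 0\<close>.\<close>
  have g_var: "\<bar>g x - g 0\<bar> \<le> B" for x
    using var[of 0 x] var[of x 0] B[of 0] by (cases x "0::real" rule: linorder_cases) auto
  have bound: "\<bar>g x\<bar> \<le> B + \<bar>g 0\<bar>" for x
    using abs_triangle_ineq2[of "g x" "g 0"] g_var[of x] by linarith
  define M where "M = B + \<bar>g 0\<bar>"
  have M: "M \<ge> 0" using bound[of 0] unfolding M_def by linarith
  show ?thesis
  \<comment> \<open>Truncating \<open>f\<close> keeps Borel measurability, which is not at hand for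
    \<open>g\<close>; where \<open>f\<close> and \<open>g\<close> agree, the truncation changes
    nothing.\<close>
  proof (rule that[of "\<lambda>x. max (- M) (min M (f x))" M])
    show "AE x in lborel. f x = max (- M) (min M (f x))"
      using g(2)
    proof eventually_elim
      case (elim x)
      then show ?case using bound[of x] unfolding M_def by auto
    qed
  qed (use f M in auto)
qed

text \<open>The averaged flux is Lipschitz in space because averaging smooths bounded functions, and
  Lipschitz in time because \<open>W_of V\<close> and \<open>w\<close> are Lipschitz. So the
  abstract flow estimate applies, with the datum as the value of \<open>X\<close> at time 0.\<close>

lemma weak_solution_time_step:
  fixes w :: "real \<Rightarrow> real \<Rightarrow> real"
  assumes kernel: "kernel_ok \<Phi>" and alpha: "\<alpha> > 0" and flux: "flux_ok V"
    and sol: "weak_solution \<Phi> \<alpha> V w w0"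
    and lip: "lipschitz_on L (UNIV \<times> {0..}) (\<lambda>p. w (fst p) (snd p))"
    and ge: "\<And>z t. t \<ge> 0 \<Longrightarrow> w z t \<ge> 1"
    and w0_lip: "\<And>x y. \<bar>w0 x - w0 y\<bar> \<le> L0 * \<bar>x - y\<bar>"
  defines "X \<equiv> \<lambda>z t. if t = 0 then w0 z else w z t"
  obtains c where "\<And>z s t. 0 \<le> s \<Longrightarrow> s < t \<Longrightarrow>
    \<bar>X z t - X z s - (nl_avg \<Phi> \<alpha> (\<lambda>x. W_of V (w x t)) (z + (t - s)\<^sup>2)
      - nl_avg \<Phi> \<alpha> (\<lambda>x. W_of V (w x t)) z) / (t - s)\<bar> \<le> c * (t - s)\<^sup>2"
proof -
  define k where "k z = indicator {0..} z * kernel_scaled \<Phi> \<alpha> z" for z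
  interpret averaging_kernel k
    unfolding k_def by (rule averaging_kernel_scaled[OF kernel alpha])
  have nl: "nl_avg \<Phi> \<alpha> = avg"
    unfolding k_def by (rule nl_avg_eq_avg[OF kernel alpha])
  obtain K M where K: "K \<ge> 0" and W_lip: "\<And>x y. x \<ge> 1 \<Longrightarrow> y \<ge> 1 \<Longrightarrow> \<bar>W_of V x - W_of V y\<bar> \<le> K * \<bar>x - y\<bar>"
    and W_le: "\<And>x. x \<ge> 1 \<Longrightarrow> \<bar>W_of V x\<bar> \<le> M"
    by (rule W_of_regular[OF flux]) blast
  have L: "L \<ge> 0" by (rule lipschitz_on_nonneg[OF lip])
  have w_space: "\<bar>w x t - w y t\<bar> \<le> L * \<bar>x - y\<bar>" if "t \<ge> 0" for x y t
    using lipschitz_onD[OF lip, of "(x, t)" "(y, t)"] that by (simp add: dist_Pair_Pair dist_real_def)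
  have w_time: "\<bar>w x s - w x t\<bar> \<le> L * \<bar>s - t\<bar>" if "s \<ge> 0" "t \<ge> 0" for x s t
    using lipschitz_onD[OF lip, of "(x, s)" "(x, t)"] that by (simp add: dist_Pair_Pair dist_real_def)
  define H where "H t x = W_of V (w x t)" for t x
  have H_le: "\<bar>H t x\<bar> \<le> M" if "t \<ge> 0" for x t
    unfolding H_def by (intro W_le ge that)
  have H_space: "\<bar>H t x - H t y\<bar> \<le> (K * L) * \<bar>x - y\<bar>" if "t \<ge> 0" for x y t
    unfolding H_def mult.assoc
    by (rule order_trans[OF W_lip mult_left_mono[OF w_space K]]) (use ge that in auto)
  have H_time: "\<bar>H s x - H t x\<bar> \<le> (K * L) * \<bar>s - t\<bar>" if "s \<ge> 0" "t \<ge> 0" for x s t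
    unfolding H_def mult.assoc
    by (rule order_trans[OF W_lip mult_left_mono[OF w_time K]]) (use ge that in auto)
  have H_meas: "H t \<in> borel_measurable borel" if "t \<ge> 0" for t
    by (rule borel_measurable_continuous_onI, rule lipschitz_bound_continuous) (rule H_space[OF that])
  have H_diff: "avg (\<lambda>x. H s x - H t x) z = avg (H s) z - avg (H t) z" if "s \<ge> 0" "t \<ge> 0" for s t z
    by (rule avg_diff[OF H_meas H_le H_meas H_le]) (use that in auto)
  \<comment> \<open>One spatial constant must serve both the datum at time 0 and the solution at
    later times, hence the sum.\<close>
  interpret flow: lipschitz_weak_flow X "\<lambda>z t. avg (H t) z" "\<bar>L\<bar> + \<bar>L0\<bar>" "2 * k 0 * M" "K * L"
  proof
    fix T R :: real and f f' :: "real \<Rightarrow> real"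
    assume T: "T > 0" and f: "f \<in> smooth_funs" "\<And>x. (f has_real_derivative f' x) (at x)" "\<And>x. \<bar>x\<bar> > R \<Longrightarrow> f x = 0"
    have "deriv f x = f' x" for x by (rule DERIV_imp_deriv[OF f(2)])
    moreover have "(LINT t:{0..T}|lborel. (LINT z|lborel. w z t * deriv (\<lambda>s. f z) t
        - avg (H t) z * deriv (\<lambda>s. f s) z)) = (LINT z|lborel. w z T * f z - w0 z * f z)"
      using sol T test_fun_time_independent[OF f(1,3), of R T]
      unfolding weak_solution_def nl H_def by blast
    ultimately show "(LINT t:{0..T}|lborel. (LINT z|lborel. - (avg (H t) z * f' z))) = (LINT z|lborel. (X z T - X z 0) * f z)"
      using T unfolding X_def by (simp add: left_diff_distrib)
  next
    fix x y t :: real assume t: "t \<ge> 0"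
    have "L * \<bar>x - y\<bar> \<le> (\<bar>L\<bar> + \<bar>L0\<bar>) * \<bar>x - y\<bar>" "L0 * \<bar>x - y\<bar> \<le> (\<bar>L\<bar> + \<bar>L0\<bar>) * \<bar>x - y\<bar>"
      by (intro mult_right_mono; simp)+
    then show "\<bar>X x t - X y t\<bar> \<le> (\<bar>L\<bar> + \<bar>L0\<bar>) * \<bar>x - y\<bar>"
      unfolding X_def using w0_lip[of x y] w_space[OF t, of x y] by auto
    show "\<bar>avg (H t) x - avg (H t) y\<bar> \<le> 2 * k 0 * M * \<bar>x - y\<bar>"
      by (rule avg_lipschitz[OF H_meas[OF t] H_le[OF t]])
  next
    fix x s t :: real assume "s \<ge> 0" "t \<ge> 0"
    then show "\<bar>avg (H s) x - avg (H t) x\<bar> \<le> K * L * \<bar>s - t\<bar>"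
      unfolding H_diff[OF \<open>s \<ge> 0\<close> \<open>t \<ge> 0\<close>, symmetric]
      by (intro avg_abs_le H_time borel_measurable_diff H_meas)
  qed
  show ?thesis
  proof (rule that)
    fix z s t :: real assume st: "0 \<le> s" "s < t"
    show "\<bar>X z t - X z s - (nl_avg \<Phi> \<alpha> (\<lambda>x. W_of V (w x t)) (z + (t - s)\<^sup>2)
      - nl_avg \<Phi> \<alpha> (\<lambda>x. W_of V (w x t)) z) / (t - s)\<bar> \<le> (16 * (\<bar>L\<bar> + \<bar>L0\<bar>) + 2 * k 0 * (K * L)) * (t - s)\<^sup>2"
      unfolding nl H_def[symmetric]
    proof (rule flow.time_step[OF st])
      show "2 * k 0 * (K * L) \<ge> 0" using k_nonneg K L by simp
      fix r h :: real assume r: "0 \<le> r" and h: "0 \<le> h"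
      have t: "t \<ge> 0" using st by simp
      \<comment> \<open>This is the mixed increment: the time difference is bounded by
        \<open>K * L * \<bar>r - t\<bar>\<close>, and averaging it gains the factor \<open>h\<close>
        in space.\<close>
      have "\<bar>avg (\<lambda>x. H r x - H t x) (z + h) - avg (\<lambda>x. H r x - H t x) z\<bar> \<le> 2 * k 0 * ((K * L) * \<bar>r - t\<bar>) * h"
        by (rule avg_shift_le) (use H_meas r t h H_time in auto)
      then show "\<bar>avg (H r) (z + h) - avg (H r) z - (avg (H t) (z + h) - avg (H t) z)\<bar> \<le> 2 * k 0 * (K * L) * h * \<bar>r - t\<bar>"
        unfolding H_diff[OF r t] by (simp add: algebra_simps)
    qed
  qed
qed

theorem theorem5p3:
  fixes \<Phi> V y0 r0 :: "real \<Rightarrow> real" and \<alpha> :: real and w v :: "real \<Rightarrow> real \<Rightarrow> real"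
  assumes kernel: "kernel_ok \<Phi>"
    and flux: "flux_ok V"
    and alpha: "\<alpha> > 0"
    and y0_BV: "BV y0" and r0_BV: "BV r0"
    and y0_ge: "\<forall>z. y0 z \<ge> 1" and r0_ge: "\<forall>z. r0 z \<ge> 1"
    and w_bdd: "\<exists>M. \<forall>z t. t \<ge> 0 \<longrightarrow> \<bar>w z t\<bar> \<le> M"
    and w_lip: "\<exists>L. lipschitz_on L (UNIV \<times> {0..}) (\<lambda>p. w (fst p) (snd p))"
    and w_ge: "\<forall>z t. t \<ge> 0 \<longrightarrow> w z t \<ge> 1"
    and w_sol: "weak_solution \<Phi> \<alpha> V w (nl_avg \<Phi> \<alpha> y0)"
    and v_bdd: "\<exists>M. \<forall>z t. t \<ge> 0 \<longrightarrow> \<bar>v z t\<bar> \<le> M"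
    and v_lip: "\<exists>L. lipschitz_on L (UNIV \<times> {0..}) (\<lambda>p. v (fst p) (snd p))"
    and v_ge: "\<forall>z t. t \<ge> 0 \<longrightarrow> v z t \<ge> 1"
    and v_sol: "weak_solution \<Phi> \<alpha> V v (nl_avg \<Phi> \<alpha> r0)"
    and L1: "integrable lborel (\<lambda>z. y0 z - r0 z)"
  shows "\<forall>t>0. integrable lborel (\<lambda>z. w z t - v z t) \<and>
           (LINT z|lborel. \<bar>w z t - v z t\<bar>) \<le> (LINT z|lborel. \<bar>y0 z - r0 z\<bar>)"
proof -
  define k where "k z = indicator {0..} z * kernel_scaled \<Phi> \<alpha> z" for z
  interpret averaging_kernel k
    unfolding k_def by (rule averaging_kernel_scaled[OF kernel alpha])
  have nl: "nl_avg \<Phi> \<alpha> = avg"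
    unfolding k_def by (rule nl_avg_eq_avg[OF kernel alpha])
  have y0_meas: "y0 \<in> borel_measurable borel" and r0_meas: "r0 \<in> borel_measurable borel"
    using y0_BV r0_BV by (auto simp: BV_def)
  obtain y My where y: "y \<in> borel_measurable borel" "\<And>x. \<bar>y x\<bar> \<le> My" "AE x in lborel. y0 x = y x"
    by (rule BV_bounded_representative[OF y0_BV]) blast
  obtain r Mr where r: "r \<in> borel_measurable borel" "\<And>x. \<bar>r x\<bar> \<le> Mr" "AE x in lborel. r0 x = r x"
    by (rule BV_bounded_representative[OF r0_BV]) blast
  have avg_y: "avg y0 = avg y" and avg_r: "avg r0 = avg r"
    using avg_AE_cong[OF y(3) y0_meas y(1)] avg_AE_cong[OF r(3) r0_meas r(1)] by auto
  obtain Lw where Lw: "lipschitz_on Lw (UNIV \<times> {0..}) (\<lambda>p. w (fst p) (snd p))" using w_lip by blast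
  obtain Lv where Lv: "lipschitz_on Lv (UNIV \<times> {0..}) (\<lambda>p. v (fst p) (snd p))" using v_lip by blast
  \<comment> \<open>At time 0 the prescribed datum stands in for the solution, as in the weak
    formulation. Each time step takes the flux at its later end, so flux properties are called for
    at positive times only.\<close>
  define X where "X z t = (if t = 0 then nl_avg \<Phi> \<alpha> y0 z else w z t)" for z t
  define Y where "Y z t = (if t = 0 then nl_avg \<Phi> \<alpha> r0 z else v z t)" for z t
  \<comment> \<open>Averaging makes the bounded representative Lipschitz; this supplies the constant
    \<open>L0\<close> of \<open>weak_solution_time_step\<close>.\<close>
  have y0_lip: "\<bar>nl_avg \<Phi> \<alpha> y0 x - nl_avg \<Phi> \<alpha> y0 z\<bar> \<le> (2 * k 0 * My) * \<bar>x - z\<bar>" for x z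
    unfolding nl avg_y by (rule avg_lipschitz[OF y(1,2)])
  have r0_lip: "\<bar>nl_avg \<Phi> \<alpha> r0 x - nl_avg \<Phi> \<alpha> r0 z\<bar> \<le> (2 * k 0 * Mr) * \<bar>x - z\<bar>" for x z
    unfolding nl avg_r by (rule avg_lipschitz[OF r(1,2)])
  define Hw where "Hw t x = W_of V (w x t)" for t x
  define Hv where "Hv t x = W_of V (v x t)" for t x
  obtain cw where cw: "\<And>z s t. 0 \<le> s \<Longrightarrow> s < t \<Longrightarrow>
      \<bar>X z t - X z s - (avg (Hw t) (z + (t - s)\<^sup>2) - avg (Hw t) z) / (t - s)\<bar> \<le> cw * (t - s)\<^sup>2"
    by (rule weak_solution_time_step[OF kernel alpha flux w_sol Lw _ y0_lip])
      (use w_ge in \<open>auto simp: X_def Hw_def[abs_def] nl\<close>)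
  obtain cv where cv: "\<And>z s t. 0 \<le> s \<Longrightarrow> s < t \<Longrightarrow>
      \<bar>Y z t - Y z s - (avg (Hv t) (z + (t - s)\<^sup>2) - avg (Hv t) z) / (t - s)\<bar> \<le> cv * (t - s)\<^sup>2"
    by (rule weak_solution_time_step[OF kernel alpha flux v_sol Lv _ r0_lip])
      (use v_ge in \<open>auto simp: Y_def Hv_def[abs_def] nl\<close>)
  obtain K M where K: "K \<ge> 0" and W_lip: "\<And>x y. x \<ge> 1 \<Longrightarrow> y \<ge> 1 \<Longrightarrow> \<bar>W_of V x - W_of V y\<bar> \<le> K * \<bar>x - y\<bar>"
    and W_le: "\<And>x. x \<ge> 1 \<Longrightarrow> \<bar>W_of V x\<bar> \<le> M"
    and W_mono: "\<And>x y. x \<ge> 1 \<Longrightarrow> x \<le> y \<Longrightarrow> W_of V x \<le> W_of V y"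
    by (rule W_of_regular[OF flux]) blast
  have w_space: "\<bar>w x t - w y t\<bar> \<le> Lw * \<bar>x - y\<bar>" if "t \<ge> 0" for x y t
    using lipschitz_onD[OF Lw, of "(x, t)" "(y, t)"] that by (simp add: dist_Pair_Pair dist_real_def)
  have v_space: "\<bar>v x t - v y t\<bar> \<le> Lv * \<bar>x - y\<bar>" if "t \<ge> 0" for x y t
    using lipschitz_onD[OF Lv, of "(x, t)" "(y, t)"] that by (simp add: dist_Pair_Pair dist_real_def)
  have Hw_le: "\<bar>Hw t x\<bar> \<le> M" and Hv_le: "\<bar>Hv t x\<bar> \<le> M" if "t > 0" for x t
    unfolding Hw_def Hv_def using w_ge v_ge that by (auto intro!: W_le)
  have Hw_lip: "\<bar>Hw t x - Hw t z\<bar> \<le> (K * Lw) * \<bar>x - z\<bar>" if "t > 0" for x z t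
    unfolding Hw_def mult.assoc
    by (rule order_trans[OF W_lip mult_left_mono[OF w_space K]]) (use w_ge that in auto)
  have Hv_lip: "\<bar>Hv t x - Hv t z\<bar> \<le> (K * Lv) * \<bar>x - z\<bar>" if "t > 0" for x z t
    unfolding Hv_def mult.assoc
    by (rule order_trans[OF W_lip mult_left_mono[OF v_space K]]) (use v_ge that in auto)
  have Hw_meas: "Hw t \<in> borel_measurable borel" and Hv_meas: "Hv t \<in> borel_measurable borel" if "t > 0" for t
    by (rule borel_measurable_continuous_onI, rule lipschitz_bound_continuous, rule Hw_lip[OF that] Hv_lip[OF that])+
  \<comment> \<open>The initial difference is an average of \<open>y - r\<close>, so
    \<open>avg_L1\<close> bounds its L1 norm by that of \<open>y0 - r0\<close>.\<close>
  have u0: "X z 0 - Y z 0 = avg (\<lambda>x. y x - r x) z" for z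
    unfolding X_def Y_def nl avg_y avg_r by (simp add: avg_diff[OF y(1,2) r(1,2)])
  have AE_eq: "AE x in lborel. y0 x - r0 x = y x - r x"
    using y(3) r(3) by eventually_elim simp
  have yr_int: "integrable lborel (\<lambda>x. y x - r x)"
    by (rule integrable_cong_AE_imp[OF L1]) (use AE_eq y r in auto)
  have yr_eq: "(LINT x|lborel. \<bar>y x - r x\<bar>) = (LINT x|lborel. \<bar>y0 x - r0 x\<bar>)"
    by (rule integral_cong_AE) (use AE_eq y r y0_meas r0_meas in auto)
  interpret flow: sign_coupled_flow k "\<lambda>z t. X z t - Y z t" "\<lambda>z t. Hw t z - Hv t z" "2 * M"
    "K * Lw + K * Lv" "cw + cv" K
  proof
    fix t :: real assume t: "t \<ge> 0"
    have "continuous_on UNIV (\<lambda>z. X z t)"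
      unfolding X_def using lipschitz_bound_continuous[OF y0_lip] lipschitz_bound_continuous[OF w_space[OF t]]
      by (cases "t = 0") auto
    moreover have "continuous_on UNIV (\<lambda>z. Y z t)"
      unfolding Y_def using lipschitz_bound_continuous[OF r0_lip] lipschitz_bound_continuous[OF v_space[OF t]]
      by (cases "t = 0") auto
    ultimately show "continuous_on UNIV (\<lambda>z. X z t - Y z t)" by (rule continuous_on_diff)
  next
    fix z t :: real assume t: "t > 0"
    show "\<bar>Hw t z - Hv t z\<bar> \<le> 2 * M" using Hw_le[OF t, of z] Hv_le[OF t, of z] by linarith
    have ge: "w z t \<ge> 1" "v z t \<ge> 1" using w_ge v_ge t by auto
    \<comment> \<open>Monotonicity of \<open>W_of V\<close> aligns the signs. Where the solutions
      agree the fluxes agree as well, so the value \<open>sgn 0 = 0\<close> does no harm.\<close>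
    show "sgn (X z t - Y z t) * (Hw t z - Hv t z) = \<bar>Hw t z - Hv t z\<bar>"
      using t W_mono[OF ge(1), of "v z t"] W_mono[OF ge(2), of "w z t"]
      unfolding X_def Y_def Hw_def Hv_def by (auto simp: sgn_if)
    show "\<bar>Hw t z - Hv t z\<bar> \<le> K * \<bar>X z t - Y z t\<bar>"
      using W_lip[OF ge] t by (simp add: X_def Y_def Hw_def Hv_def)
  next
    fix x z t :: real assume t: "t > 0"
    show "\<bar>Hw t x - Hv t x - (Hw t z - Hv t z)\<bar> \<le> (K * Lw + K * Lv) * \<bar>x - z\<bar>"
      using Hw_lip[OF t, of x z] Hv_lip[OF t, of x z] by (simp add: algebra_simps)
  next
    fix z s t :: real assume st: "0 \<le> s" "s < t"
    then have t: "t > 0" by simp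
    have diff: "avg (\<lambda>x. Hw t x - Hv t x) x = avg (Hw t) x - avg (Hv t) x" for x
      by (rule avg_diff[OF Hw_meas[OF t] Hw_le[OF t] Hv_meas[OF t] Hv_le[OF t]])
    have "X z t - Y z t - (X z s - Y z s)
        - (avg (Hw t) (z + (t - s)\<^sup>2) - avg (Hv t) (z + (t - s)\<^sup>2) - (avg (Hw t) z - avg (Hv t) z)) / (t - s)
      = (X z t - X z s - (avg (Hw t) (z + (t - s)\<^sup>2) - avg (Hw t) z) / (t - s))
      - (Y z t - Y z s - (avg (Hv t) (z + (t - s)\<^sup>2) - avg (Hv t) z) / (t - s))"
      by (simp add: diff_divide_distrib)
    then show "\<bar>X z t - Y z t - (X z s - Y z s)
        - (avg (\<lambda>x. Hw t x - Hv t x) (z + (t - s)\<^sup>2) - avg (\<lambda>x. Hw t x - Hv t x) z) / (t - s)\<bar>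
      \<le> (cw + cv) * (t - s)\<^sup>2"
      unfolding diff distrib_right using cw[OF st, of z] cv[OF st, of z] by linarith
  next
    show "integrable lborel (\<lambda>z. X z 0 - Y z 0)" unfolding u0 by (rule avg_L1(1)[OF yr_int])
  qed (rule K)
  show ?thesis
  proof (intro allI impI)
    fix t :: real assume t: "t > 0"
    have eq: "X z t - Y z t = w z t - v z t" for z using t by (simp add: X_def Y_def)
    show "integrable lborel (\<lambda>z. w z t - v z t) \<and>
           (LINT z|lborel. \<bar>w z t - v z t\<bar>) \<le> (LINT z|lborel. \<bar>y0 z - r0 z\<bar>)"
      using flow.L1_bound_crude(1)[OF t] flow.L1_contraction[OF t] avg_L1(2)[OF yr_int] yr_eq
      unfolding eq u0 by simp
  qed
qed

end
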